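(* Let $G$ be a finitely generated group. Then $\dim_{\mathbb{Q}} B(G)\otimes\mathbb{Q}<\infty$ if and only if $\mathcal{V}(G)$ is a finite set.
   Context: $B(G)=G'/G''=H_1(G',\mathbb{Z})$ is the Alexander invariant, where $G'$ is the commutator subgroup of $G$ and $G''$ is the commutator subgroup of $G'$. $\mathbb{T}(G)=\mathrm{Hom}(G,\mathbb{C}^\times)$ is the character group; for $\rho\in\mathbb{T}(G)$, $\mathbb{C}_\rho$ denotes $\mathbb{C}$ viewed as a $\mathbb{C}G$-module via $g\cdot a=\rho(g)a$. The (first) characteristic variety is $\mathcal{V}(G)=\{\rho\in\mathbb{T}(G)\mid \dim_{\mathbb{C}}H_1(G,\mathbb{C}_\rho)\ge 1\}$. *)

theory Defs
  imports
    "HOL-Algebra.Free_Abelian_Groups"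
    "Jordan_Normal_Form.VS_Connect"
    "HOL-Algebra.AbelCoset"
begin

definition finitely_generated_group :: "('a, 'b) monoid_scheme \<Rightarrow> bool" where
  "finitely_generated_group G \<longleftrightarrow>
     group G \<and> (\<exists>S. finite S \<and> S \<subseteq> carrier G \<and> generate G S = carrier G)"

definition commutator_subgroup :: "('a, 'b) monoid_scheme \<Rightarrow> ('a, 'b) monoid_scheme" where
  "commutator_subgroup G = G\<lparr>carrier := derived G (carrier G)\<rparr>"

definition alexander_invariant :: "('a, 'b) monoid_scheme \<Rightarrow> 'a set monoid" where
  "alexander_invariant G =
     commutator_subgroup G Mod carrier (commutator_subgroup (commutator_subgroup G))"

text \<open>The tensor product of a multiplicatively written abelian group \<open>A\<close> with the rationals over
  the integers: the free abelian group on the pairs \<open>(a, r)\<close>, modulo biadditivity. The scalar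
  \<open>q\<close> acts by \<open>q (a \<otimes> r) = a \<otimes> (q r)\<close>. The ring multiplication fields of the
  \<^type>\<open>module\<close> records below carry no information.\<close>

definition rat_tensor_gens :: "('a, 'b) monoid_scheme \<Rightarrow> ('a \<times> rat \<Rightarrow>\<^sub>0 int) monoid" where
  "rat_tensor_gens A = free_Abelian_group (carrier A \<times> UNIV)"

definition rat_tensor_relations :: "('a, 'b) monoid_scheme \<Rightarrow> ('a \<times> rat \<Rightarrow>\<^sub>0 int) set" where
  "rat_tensor_relations A = generate (rat_tensor_gens A)
     ({frag_of (a \<otimes>\<^bsub>A\<^esub> b, r) - frag_of (a, r) - frag_of (b, r) | a b r.
         a \<in> carrier A \<and> b \<in> carrier A} \<union>
      {frag_of (a, r + s) - frag_of (a, r) - frag_of (a, s) | a r s. a \<in> carrier A})"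

definition rat_scale :: "rat \<Rightarrow> ('a \<times> rat \<Rightarrow>\<^sub>0 int) \<Rightarrow> ('a \<times> rat \<Rightarrow>\<^sub>0 int)" where
  "rat_scale q = frag_extend (\<lambda>(a, r). frag_of (a, q * r))"

definition tensor_rat :: "('a, 'b) monoid_scheme \<Rightarrow> (rat, ('a \<times> rat \<Rightarrow>\<^sub>0 int) set) module" where
  "tensor_rat A =
     (let F = rat_tensor_gens A; N = rat_tensor_relations A in
      \<lparr>carrier = rcosets\<^bsub>F\<^esub> N, mult = undefined, one = undefined, zero = N, add = set_mult F,
       smult = (\<lambda>q X. \<Union>x\<in>X. N #>\<^bsub>F\<^esub> rat_scale q x)\<rparr>)"

definition quotient_module ::
  "('r, 'm, 'c) module_scheme \<Rightarrow> 'm set \<Rightarrow> ('r, 'm set) module" where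
  "quotient_module M N =
     \<lparr>carrier = a_rcosets\<^bsub>M\<^esub> N, mult = undefined, one = undefined, zero = N, add = set_add M,
      smult = (\<lambda>a X. \<Union>x\<in>X. N +>\<^bsub>M\<^esub> (a \<odot>\<^bsub>M\<^esub> x))\<rparr>"

text \<open>First homology of \<open>G\<close> with coefficients in a \<open>kG\<close>-module whose underlying vector space is
  \<open>k\<close>, with \<open>act g\<close> the left action of \<open>g\<close>. It is computed by the bar complex
  \<open>k \<otimes>\<^bsub>kG\<^esub> Bar(kG) \<otimes>\<^bsub>kG\<^esub> M\<close>: an \<open>n\<close>-chain is a finite sum of symbols \<open>[g\<^sub>1|\<dots>|g\<^sub>n] x\<close>, with
  \<open>d([g] x) = x - g x\<close> and \<open>d([g|h] x) = [h] x - [gh] x + [g] (h x)\<close>.\<close>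

definition bar_d1 :: "('a \<Rightarrow> 'k \<Rightarrow> 'k) \<Rightarrow> ('a \<Rightarrow>\<^sub>0 'k::field) \<Rightarrow> 'k" where
  "bar_d1 act c =
     (\<Sum>g\<in>Poly_Mapping.keys c. Poly_Mapping.lookup c g - act g (Poly_Mapping.lookup c g))"

definition bar_d2 :: "('a, 'b) monoid_scheme \<Rightarrow> ('a \<Rightarrow> 'k \<Rightarrow> 'k) \<Rightarrow>
    ('a \<times> 'a \<Rightarrow>\<^sub>0 'k::field) \<Rightarrow> ('a \<Rightarrow>\<^sub>0 'k)" where
  "bar_d2 G act c =
     (\<Sum>(g, h)\<in>Poly_Mapping.keys c. let x = Poly_Mapping.lookup c (g, h) in
        Poly_Mapping.single h x - Poly_Mapping.single (g \<otimes>\<^bsub>G\<^esub> h) x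
        + Poly_Mapping.single g (act h x))"

definition bar_cycles1 ::
  "('a, 'b) monoid_scheme \<Rightarrow> ('a \<Rightarrow> 'k \<Rightarrow> 'k) \<Rightarrow> ('k::field, 'a \<Rightarrow>\<^sub>0 'k) module" where
  "bar_cycles1 G act =
     \<lparr>carrier = {c. Poly_Mapping.keys c \<subseteq> carrier G \<and> bar_d1 act c = 0},
      mult = undefined, one = undefined, zero = 0, add = (+),
      smult = (\<lambda>a. Poly_Mapping.map ((*) a))\<rparr>"

definition bar_boundaries1 ::
  "('a, 'b) monoid_scheme \<Rightarrow> ('a \<Rightarrow> 'k \<Rightarrow> 'k) \<Rightarrow> ('a \<Rightarrow>\<^sub>0 'k::field) set" where
  "bar_boundaries1 G act =
     bar_d2 G act ` {c. Poly_Mapping.keys c \<subseteq> carrier G \<times> carrier G}"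

definition group_homology1 ::
  "('a, 'b) monoid_scheme \<Rightarrow> ('a \<Rightarrow> 'k \<Rightarrow> 'k) \<Rightarrow> ('k::field, ('a \<Rightarrow>\<^sub>0 'k) set) module" where
  "group_homology1 G act = quotient_module (bar_cycles1 G act) (bar_boundaries1 G act)"

text \<open>Characters are chosen to be \<^const>\<open>undefined\<close> outside the carrier, so that distinct elements
  of the character group are distinct as homomorphisms.\<close>

definition character_group :: "('a, 'b) monoid_scheme \<Rightarrow> ('a \<Rightarrow> complex) set" where
  "character_group G = hom G (units_of class_ring) \<inter> extensional (carrier G)"

definition character_action :: "('a \<Rightarrow> complex) \<Rightarrow> 'a \<Rightarrow> complex \<Rightarrow> complex" where
  "character_action \<rho> g a = \<rho> g * a"

text \<open>\<^const>\<open>vectorspace.dim\<close> is meaningful for finite-dimensional spaces only, so infinite dimension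
  is listed separately in the condition that the dimension is at least one.\<close>

definition characteristic_variety :: "('a, 'b) monoid_scheme \<Rightarrow> ('a \<Rightarrow> complex) set" where
  "characteristic_variety G =
     {\<rho> \<in> character_group G.
        let H = group_homology1 G (character_action \<rho>) in
        vectorspace.fin_dim class_ring H \<longrightarrow> 1 \<le> vectorspace.dim class_ring H}"

end

theory Submission
  imports Defs
    "HOL-Analysis.Continuum_Not_Denumerable"
    "HOL-Computational_Algebra.Fundamental_Theorem_Algebra"
begin

text \<open>For a character \<open>\<rho> \<noteq> 1\<close>, a linear functional on chains that kills the boundaries is a crossed
  homomorphism. Restricting it to \<open>G'\<close> shows that \<open>\<rho>\<close> lies in the characteristic variety iff there is a
  nonzero additive \<open>f : G' \<rightarrow> \<complex>\<close> with \<open>f (g x g\<^sup>-\<^sup>1) = \<rho>(g)\<^sup>-\<^sup>1 f(x)\<close>, that is, a common eigenvector of the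
  conjugation action of \<open>G\<close> on the dual of \<open>B(G) \<otimes> \<complex>\<close>.

  Eigenvectors for distinct characters are linearly independent, so there are finitely many if
  \<open>B(G) \<otimes> \<rat>\<close> has finite dimension. Conversely, \<open>B(G) \<otimes> \<complex>\<close> is generated by the commutators of the
  generators of \<open>G\<close> under finitely many commuting operators. If its dimension is infinite, Zorn's lemma
  gives an infinite-dimensional quotient module \<open>M\<close> all of whose proper quotients have finite dimension.
  On \<open>M\<close> some operator \<open>t\<close> has all its shifts \<open>t - a\<close> injective, and since \<open>M\<close> has countable dimension
  while \<open>\<complex>\<close> is uncountable, infinitely many of them are not surjective. Each nonzero \<open>M / (t - a) M\<close> has
  a one-dimensional quotient on which \<open>t\<close> acts as \<open>a\<close>.\<close>

section \<open>Commuting operators\<close>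

text \<open>Quotient spaces are avoided throughout the linear algebra: a module is a space with a
  subspace of relations, and equality means that the difference is a relation. Hence the many
  statements modulo \<open>N\<close> or \<open>N0\<close>. The trivial character has to be set aside
  because its crossed homomorphisms are plain homomorphisms to the complex numbers, and these all
  vanish on \<open>G'\<close>. As a single point it cannot affect finiteness. Zorn's lemma applies
  because finite generation makes finite codimension pass from the union of a chain to one of its
  members. Uncountability enters as follows: an operator with every shift bijective would make its
  space a vector space over the rational functions in that operator, and the fractions 1/(t - a) are
  uncountably many independent elements of this field. The dimension over the rationals and the one
  over the complex numbers are compared through additive complex-valued functions in one direction,
  and through a rational-linear retraction of the complex numbers in the other.\<close>

lemma uncountable_UNIV_complex: "uncountable (UNIV :: complex set)"
proof
  assume "countable (UNIV :: complex set)"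
  then have "countable (range complex_of_real)"
    by (rule countable_subset[rotated]) simp
  then have "countable (UNIV :: real set)"
    by (rule countable_image_inj_on) (simp add: inj_on_def)
  then show False
    using uncountable_UNIV_real by simp
qed

text \<open>Two indices with the same vector would already give a nontrivial relation, with
  coefficients 1 and -1. A finite-dimensional bound on the vectors thus bounds the number of
  indices, which are complex shifts in one use and characters in the other.\<close>

lemma (in vector_space) independent_family:
  assumes "\<And>F c. finite F \<Longrightarrow> F \<subseteq> I \<Longrightarrow> (\<Sum>i\<in>F. scale (c i) (d i)) = 0 \<Longrightarrow> \<forall>i\<in>F. c i = 0"
  shows "inj_on d I" "independent (d ` I)"
proof -
  show "inj_on d I"
  proof (rule inj_onI, rule ccontr)
    fix i j assume ij: "i \<in> I" "j \<in> I" "d i = d j" "i \<noteq> j"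
    have "\<forall>k\<in>{i, j}. (if k = i then 1 else - 1 :: 'a) = 0"
      by (rule assms) (use ij in auto)
    then show False by simp
  qed
  show "independent (d ` I)"
    unfolding independent_explicit_finite_subsets
  proof (intro allI impI ballI)
    fix S u x assume S: "S \<subseteq> d ` I" "finite S" and rel: "(\<Sum>v\<in>S. scale (u v) v) = 0" and x: "x \<in> S"
    obtain F where F: "F \<subseteq> I" "inj_on d F" "S = d ` F"
      using S(1) by (auto simp: subset_image_inj)
    then have "finite F" using S(2) by (simp add: finite_image_iff)
    have rel': "(\<Sum>i\<in>F. scale (u (d i)) (d i)) = 0" using rel F by (simp add: sum.reindex)
    obtain i where "i \<in> F" "x = d i" using x F by blast
    then show "u x = 0" using assms[OF \<open>finite F\<close> F(1) rel'] by blast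
  qed
qed

text \<open>The pair \<open>t\<close>, \<open>N\<close> encodes the operator induced on the quotient
  by \<open>N\<close>; membership in \<open>N\<close> takes the place of being zero.\<close>

locale endomorphism_stable = vector_space scale
  for scale :: "complex \<Rightarrow> 'b::ab_group_add \<Rightarrow> 'b" (infixr "*s" 75) +
  fixes t :: "'b \<Rightarrow> 'b" and N :: "'b set"
  assumes lin: "Vector_Spaces.linear scale scale t"
    and N: "subspace N"
    and tN: "v \<in> N \<Longrightarrow> t v \<in> N"
begin

lemma t_add: "t (u + v) = t u + t v"
  and t_scale: "t (c *s v) = c *s t v"
  and t_zero [simp]: "t 0 = 0"
proof -
  interpret t: Vector_Spaces.linear scale scale t by (fact lin)
  show "t (u + v) = t u + t v" "t (c *s v) = c *s t v" "t 0 = 0"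
    by (rule t.add t.scale t.zero)+
qed

text \<open>Horner's scheme for the vector p(t) v. It makes the space a module over the complex
  polynomials.\<close>

definition poly_op :: "complex poly \<Rightarrow> 'b \<Rightarrow> 'b" where
  "poly_op p v = fold_coeffs (\<lambda>a w. a *s v + t w) p 0"

lemma poly_op_0 [simp]: "poly_op 0 v = 0"
  by (simp add: poly_op_def)

lemma poly_op_pCons [simp]: "poly_op (pCons a p) v = a *s v + t (poly_op p v)"
  by (cases "p = 0 \<and> a = 0") (auto simp: poly_op_def)

lemma poly_op_add: "poly_op (p + q) v = poly_op p v + poly_op q v"
  by (induction p q rule: poly_induct2) (simp_all add: scale_left_distrib t_add)

lemma poly_op_smult: "poly_op (smult c p) v = c *s poly_op p v"
  by (induction p) (simp_all add: scale_right_distrib t_scale)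

lemma poly_op_sum: "poly_op (sum f A) v = (\<Sum>a\<in>A. poly_op (f a) v)"
  by (induction A rule: infinite_finite_induct) (simp_all add: poly_op_add)

lemma poly_op_vadd: "poly_op p (u + v) = poly_op p u + poly_op p v"
  by (induction p) (simp_all add: scale_right_distrib t_add)

lemma poly_op_vscale: "poly_op p (c *s v) = c *s poly_op p v"
  by (induction p) (simp_all add: scale_right_distrib t_scale mult.commute)

lemma poly_op_vdiff: "poly_op p (u - v) = poly_op p u - poly_op p v"
  by (metis poly_op_vadd add_diff_cancel diff_add_cancel)

lemma poly_op_vzero [simp]: "poly_op p 0 = 0"
  by (induction p) simp_all

lemma poly_op_vsum: "poly_op p (sum f A) = (\<Sum>a\<in>A. poly_op p (f a))"
  by (induction A rule: infinite_finite_induct) (simp_all add: poly_op_vadd)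

lemma poly_op_t: "poly_op p (t v) = t (poly_op p v)"
  by (induction p) (simp_all add: t_add t_scale)

lemma poly_op_linear_factor:
  "poly_op ([:- a, 1:] * p) v = t (poly_op p v) - a *s poly_op p v"
proof -
  have "[:- a, 1:] * p = pCons 0 p + smult (- a) p" by simp
  then show ?thesis by (simp only: poly_op_add poly_op_smult poly_op_pCons) simp
qed

lemma poly_op_in: "v \<in> N \<Longrightarrow> poly_op p v \<in> N"
  by (induction p) (auto intro: subspace_0 subspace_add subspace_scale N tN)

text \<open>Over the complex numbers a nonzero polynomial is a constant times linear factors, and
  the hypothesis cancels these one at a time.\<close>

lemma poly_op_injective_mod:
  assumes inj: "\<And>a v. t v - a *s v \<in> N \<Longrightarrow> v \<in> N"
    and "p \<noteq> 0" "poly_op p v \<in> N"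
  shows "v \<in> N"
  using assms(2,3)
proof (induction "degree p" arbitrary: p)
  case 0
  then obtain c where p: "p = [:c:]" and "c \<noteq> 0"
    by (metis degree_eq_zeroE pCons_0_0)
  have "inverse c *s (c *s v) \<in> N"
    using 0 p by (intro subspace_scale[OF N, of "c *s v"]) simp
  moreover have "inverse c *s (c *s v) = v" using \<open>c \<noteq> 0\<close> by simp
  ultimately show ?case by metis
next
  case (Suc n)
  then obtain a where "poly p a = 0"
    by (metis fundamental_theorem_of_algebra constant_degree nat.distinct(1))
  then obtain q where q: "p = [:- a, 1:] * q"
    by (metis poly_eq_0_iff_dvd dvd_def)
  have "q \<noteq> 0" using q Suc.prems by auto
  moreover have "n = degree q"
    using Suc.hyps(2) \<open>q \<noteq> 0\<close> unfolding q by (subst (asm) degree_mult_eq) auto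
  moreover have "poly_op q v \<in> N"
    using Suc.prems(2) unfolding q poly_op_linear_factor by (rule inj)
  ultimately show ?case using Suc.hyps(1) by blast
qed

text \<open>The resolvent vectors \<open>(t - a)\<^sup>-\<^sup>1 m\<close> are linearly independent: clearing denominators in a
  relation between them gives a nonzero polynomial in \<open>t\<close> that annihilates \<open>m\<close>.\<close>

lemma resolvents_independent:
  assumes inj: "\<And>a v. t v - a *s v \<in> N \<Longrightarrow> v \<in> N"
    and m: "m \<notin> N"
    and r: "\<And>a. a \<in> F \<Longrightarrow> t (r a) - a *s r a - m \<in> N"
    and F: "finite F" and rel: "(\<Sum>a\<in>F. c a *s r a) \<in> N" and b: "b \<in> F"
  shows "c b = 0"
proof (rule ccontr)
  assume cb: "c b \<noteq> 0"
  \<comment> \<open>\<open>q a\<close> is \<open>P\<close> without its factor at \<open>a\<close>,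
    so P(t) applied to the resolvent at \<open>a\<close> is \<open>q a\<close> applied to
    \<open>m\<close>, modulo \<open>N\<close>.\<close>
  define q where "q a = (\<Prod>e\<in>F - {a}. [:- e, 1::complex:])" for a
  define P where "P = (\<Prod>e\<in>F. [:- e, 1::complex:])"
  have P: "P = [:- a, 1:] * q a" if "a \<in> F" for a
    unfolding P_def q_def using F that by (rule prod.remove)
  have *: "poly_op P (r a) - poly_op (q a) m \<in> N" if "a \<in> F" for a
  proof -
    have "poly_op P (r a) - poly_op (q a) m = poly_op (q a) (t (r a) - a *s r a - m)"
      using P[OF that] by (simp only: poly_op_linear_factor poly_op_vdiff poly_op_t poly_op_vscale)
    then show ?thesis using poly_op_in[OF r[OF that]] by simp
  qed
  have "poly_op P (\<Sum>a\<in>F. c a *s r a) - poly_op (\<Sum>a\<in>F. smult (c a) (q a)) m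
      = (\<Sum>a\<in>F. c a *s (poly_op P (r a) - poly_op (q a) m))"
    by (simp add: poly_op_vsum poly_op_sum poly_op_smult poly_op_vscale sum_subtractf
        scale_right_diff_distrib)
  also have "\<dots> \<in> N"
    using * by (intro subspace_sum subspace_scale N) auto
  finally have "poly_op P (\<Sum>a\<in>F. c a *s r a) - poly_op (\<Sum>a\<in>F. smult (c a) (q a)) m \<in> N" .
  from subspace_diff[OF N poly_op_in[OF rel, of P] this]
  have "poly_op (\<Sum>a\<in>F. smult (c a) (q a)) m \<in> N" by simp
  \<comment> \<open>Evaluation at \<open>b\<close> kills every \<open>q a\<close> with
    \<open>a\<close> different from \<open>b\<close>, but not \<open>q b\<close>, so it isolates the
    coefficient \<open>c b\<close>.\<close>
  moreover have "(\<Sum>a\<in>F. smult (c a) (q a)) \<noteq> 0"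
  proof
    assume "(\<Sum>a\<in>F. smult (c a) (q a)) = 0"
    then have "0 = poly (\<Sum>a\<in>F. smult (c a) (q a)) b" by simp
    also have "\<dots> = (\<Sum>a\<in>F. c a * poly (q a) b)" by (simp add: poly_sum)
    also have "\<dots> = (\<Sum>a\<in>{b}. c a * poly (q a) b)"
      using F b by (intro sum.mono_neutral_right) (auto simp: q_def poly_prod)
    also have "\<dots> = c b * (\<Prod>e\<in>F - {b}. b - e)"
      by (simp add: q_def poly_prod)
    finally show False using cb F by auto
  qed
  ultimately have "m \<in> N" using poly_op_injective_mod[of "\<Sum>a\<in>F. smult (c a) (q a)" m] inj by blast
  then show False using m by blast
qed

text \<open>A surjective shift yields a resolvent vector of a fixed \<open>m\<close> outside
  \<open>N\<close>, and modulo \<open>N\<close> it can be taken in the span of a finite subset of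
  \<open>C\<close>. There are only countably many such subsets, so uncountably many shifts would put
  infinitely many resolvents into one finite-dimensional span, against their independence.\<close>

lemma countably_many_surjective_shifts:
  assumes inj: "\<And>a v. t v - a *s v \<in> N \<Longrightarrow> v \<in> N"
    and C: "countable C" "span (C \<union> N) = UNIV" and "N \<noteq> UNIV"
  shows "countable {a. \<forall>m. \<exists>v. t v - a *s v - m \<in> N}"
proof (rule ccontr)
  define L where "L = {a. \<forall>m. \<exists>v. t v - a *s v - m \<in> N}"
  assume "uncountable {a. \<forall>m. \<exists>v. t v - a *s v - m \<in> N}"
  then have "uncountable L" by (simp add: L_def)
  obtain m where m: "m \<notin> N" using \<open>N \<noteq> UNIV\<close> by blast
  have "\<exists>d D. finite D \<and> D \<subseteq> C \<and> d \<in> span D \<and> t d - a *s d - m \<in> N" if a: "a \<in> L" for a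
  proof -
    obtain v where v: "t v - a *s v - m \<in> N" using a unfolding L_def by blast
    have "v \<in> span (C \<union> N)" using C by simp
    then obtain d n where d: "d \<in> span C" and n: "n \<in> span N" and "v = d + n"
      by (auto simp: span_Un)
    then have "n \<in> N" using N by (metis span_eq_iff)
    have "t d - a *s d - m = (t v - a *s v - m) - (t n - a *s n)"
      using \<open>v = d + n\<close> by (simp add: t_add scale_right_distrib)
    also have "\<dots> \<in> N"
      by (rule subspace_diff[OF N v subspace_diff[OF N tN subspace_scale[OF N]]]) fact+
    finally have "t d - a *s d - m \<in> N" .
    moreover obtain D where "finite D" "D \<subseteq> C" "d \<in> span D"
      using d by (auto simp: span_explicit intro!: span_sum span_scale span_base)
    ultimately show ?thesis by blast
  qed
  then obtain d D where D: "\<And>a. a \<in> L \<Longrightarrow> finite (D a) \<and> D a \<subseteq> C \<and> d a \<in> span (D a)"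
    and d: "\<And>a. a \<in> L \<Longrightarrow> t (d a) - a *s d a - m \<in> N"
    by metis
  have "countable (D ` L)"
    by (rule countable_subset[OF _ countable_Collect_finite_subset[OF C(1)]]) (use D in auto)
  have "\<exists>E\<in>D ` L. infinite {a \<in> L. D a = E}"
  proof (rule ccontr)
    assume "\<not> ?thesis"
    then have "countable (\<Union>E\<in>D ` L. {a \<in> L. D a = E})"
      by (intro countable_UN \<open>countable (D ` L)\<close>) (auto intro: countable_finite)
    moreover have "(\<Union>E\<in>D ` L. {a \<in> L. D a = E}) = L" by auto
    ultimately show False using \<open>uncountable L\<close> by simp
  qed
  then obtain E where E: "E \<in> D ` L" and inf: "infinite {a \<in> L. D a = E}" by blast
  define A where "A = {a \<in> L. D a = E}"
  have "\<forall>b\<in>F. c b = 0" if F: "finite F" "F \<subseteq> A" and rel: "(\<Sum>a\<in>F. c a *s d a) = 0" for F c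
  proof
    fix b assume "b \<in> F"
    show "c b = 0"
    proof (rule resolvents_independent[where F = F and r = d and c = c, OF _ m])
      show "t (d a) - a *s d a - m \<in> N" if "a \<in> F" for a using d that F(2) by (auto simp: A_def)
      show "(\<Sum>a\<in>F. c a *s d a) \<in> N" using rel subspace_0[OF N] by simp
    qed (use inj F \<open>b \<in> F\<close> in blast)+
  qed
  then have indep: "inj_on d A" "independent (d ` A)"
    by (intro independent_family; blast)+
  have "d ` A \<subseteq> span E" using D by (force simp: A_def)
  moreover have "finite E" using D E by force
  ultimately have "finite (d ` A)" by (metis independent_span_bound indep(2))
  then have "finite A" using indep(1) by (rule finite_imageD)
  then show False using inf by (simp add: A_def)
qed

end

text \<open>The quotient by \<open>N0\<close> is meant as a finitely generated module over the
  polynomial ring in the operators. Finite generation takes the form of an induction principle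
  because it is applied to subspaces such as \<open>span (Y \<union> N)\<close>.\<close>

locale commuting_operators = vector_space scale
  for scale :: "complex \<Rightarrow> 'b::ab_group_add \<Rightarrow> 'b" (infixr "*s" 75) +
  fixes T :: "'i \<Rightarrow> 'b \<Rightarrow> 'b" and I :: "'i set" and X N0 :: "'b set"
  assumes lin: "i \<in> I \<Longrightarrow> Vector_Spaces.linear scale scale (T i)"
    and finite_I: "finite I" and finite_X: "finite X"
    and N0: "subspace N0" and T_N0: "i \<in> I \<Longrightarrow> v \<in> N0 \<Longrightarrow> T i v \<in> N0"
    and commute: "i \<in> I \<Longrightarrow> j \<in> I \<Longrightarrow> T i (T j v) - T j (T i v) \<in> N0"
    and generated: "subspace W \<Longrightarrow> X \<subseteq> W \<Longrightarrow> N0 \<subseteq> W \<Longrightarrow> (\<And>i v. i \<in> I \<Longrightarrow> v \<in> W \<Longrightarrow> T i v \<in> W)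
        \<Longrightarrow> W = UNIV"
begin

text \<open>These subspaces correspond to the submodules of the quotient by
  \<open>N0\<close>.\<close>

definition stable :: "'b set \<Rightarrow> bool" where
  "stable N \<longleftrightarrow> subspace N \<and> N0 \<subseteq> N \<and> (\<forall>i\<in>I. \<forall>v\<in>N. T i v \<in> N)"

lemma stable_N0: "stable N0"
  using N0 T_N0 by (simp add: stable_def)

lemma T_simps:
  assumes "i \<in> I"
  shows "T i (u + v) = T i u + T i v" "T i (c *s v) = c *s T i v" "T i 0 = 0"
    "T i (u - v) = T i u - T i v"
proof -
  interpret t: Vector_Spaces.linear scale scale "T i" by (rule lin) fact
  show "T i (u + v) = T i u + T i v" "T i (c *s v) = c *s T i v" "T i 0 = 0"
    "T i (u - v) = T i u - T i v"
    by (rule t.add t.scale t.zero t.diff)+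
qed

lemma T_span_in:
  assumes i: "i \<in> I" and W: "subspace W" and "\<And>a. a \<in> A \<Longrightarrow> T i a \<in> W" and v: "v \<in> span A"
  shows "T i v \<in> W"
  using v
  by (induction rule: span_induct_alt)
    (use assms in \<open>auto simp: T_simps intro!: subspace_add subspace_scale intro: subspace_0\<close>)

text \<open>Since the whole space is generated by finitely many vectors under finitely many operators,
  being spanned by a stable subspace and a finite set is a condition of finite character.\<close>

lemma maximal_stable_avoiding:
  assumes YY: "\<And>Y. Y \<in> YY \<Longrightarrow> finite Y" and M: "stable M" "\<And>Y. Y \<in> YY \<Longrightarrow> span (Y \<union> M) \<noteq> UNIV"
  obtains N where "stable N" "M \<subseteq> N" "\<And>Y. Y \<in> YY \<Longrightarrow> span (Y \<union> N) \<noteq> UNIV"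
    "\<And>N'. stable N' \<Longrightarrow> N \<subset> N' \<Longrightarrow> \<exists>Y\<in>YY. span (Y \<union> N') = UNIV"
proof -
  \<comment> \<open>Two choices of \<open>YY\<close> occur later: the empty set alone gives a
    maximal proper submodule, and all finite sets give a maximal submodule of infinite
    codimension.\<close>
  define AA where "AA = {N. stable N \<and> M \<subseteq> N \<and> (\<forall>Y\<in>YY. span (Y \<union> N) \<noteq> UNIV)}"
  have "\<exists>U\<in>AA. \<forall>N\<in>CC. N \<subseteq> U" if chain: "subset.chain AA CC" for CC
  proof (cases "CC = {}")
    case True
    then show ?thesis using M by (auto simp: AA_def)
  next
    case False
    have CC: "stable N" "M \<subseteq> N" "\<forall>Y\<in>YY. span (Y \<union> N) \<noteq> UNIV" if "N \<in> CC" for N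
      using chain that by (auto simp: subset.chain_def AA_def)
    have total: "A \<subseteq> B \<or> B \<subseteq> A" if "A \<in> CC" "B \<in> CC" for A B
      using chain that by (auto simp: subset.chain_def)
    \<comment> \<open>Finitely many finite combinations involve finitely many members of the chain,
      and the largest of these serves for all.\<close>
    have common: "\<exists>N\<in>CC. F \<subseteq> span (Y \<union> N)" if "finite F" "F \<subseteq> span (Y \<union> \<Union>CC)" for F Y
      using that
    proof (induction F rule: finite_induct)
      case empty
      then show ?case using False by auto
    next
      case (insert x F)
      then obtain A where A: "A \<in> CC" "F \<subseteq> span (Y \<union> A)" by auto
      have "x \<in> span (Y \<union> \<Union>CC)" using insert by auto
      then have "\<exists>B\<in>CC. x \<in> span (Y \<union> B)"
      proof (induction rule: span_induct_alt)
        case base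
        then show ?case using False by (auto intro: span_zero)
      next
        case (step c a y)
        then obtain B where B: "B \<in> CC" "y \<in> span (Y \<union> B)" by blast
        obtain D where D: "D \<in> CC" "a \<in> Y \<union> D" using step(1) False by blast
        obtain E where E: "E \<in> CC" "B \<subseteq> E" "D \<subseteq> E" using total[OF B(1) D(1)] B(1) D(1) by blast
        have "y \<in> span (Y \<union> E)" using B(2) E(2) span_mono[of "Y \<union> B" "Y \<union> E"] by blast
        moreover have "a \<in> span (Y \<union> E)" using D(2) E(3) by (auto intro: span_base)
        ultimately show ?case using E(1) by (auto intro: span_add span_scale)
      qed
      then obtain B where B: "B \<in> CC" "x \<in> span (Y \<union> B)" by blast
      obtain E where E: "E \<in> CC" "A \<subseteq> E" "B \<subseteq> E" using total[OF A(1) B(1)] A(1) B(1) by blast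
      have "span (Y \<union> A) \<subseteq> span (Y \<union> E)" "span (Y \<union> B) \<subseteq> span (Y \<union> E)"
        using E by (auto intro!: span_mono)
      then show ?case using A B E(1) by blast
    qed
    have U: "stable (\<Union>CC)"
      unfolding stable_def
    proof (intro conjI ballI)
      show "subspace (\<Union>CC)"
      proof (rule subspaceI)
        obtain A where "A \<in> CC" using False by blast
        then show "0 \<in> \<Union>CC" using CC(1)[of A] by (auto simp: stable_def intro: subspace_0)
        show "c *s x \<in> \<Union>CC" if x: "x \<in> \<Union>CC" for c x
        proof -
          obtain A where "A \<in> CC" "x \<in> A" using x by blast
          then show ?thesis using CC(1)[of A] by (auto simp: stable_def intro: subspace_scale)
        qed
        fix x y assume "x \<in> \<Union>CC" "y \<in> \<Union>CC"
        then obtain A B where "A \<in> CC" "B \<in> CC" "x \<in> A" "y \<in> B" by blast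
        then obtain E where "E \<in> CC" "x \<in> E" "y \<in> E" using total[of A B] by blast
        then show "x + y \<in> \<Union>CC" using CC(1)[of E] by (auto simp: stable_def intro: subspace_add)
      qed
      show "N0 \<subseteq> \<Union>CC" using CC(1) False unfolding stable_def by blast
      show "T i v \<in> \<Union>CC" if "i \<in> I" "v \<in> \<Union>CC" for i v
        using that CC(1) unfolding stable_def by blast
    qed
    have "span (Y \<union> \<Union>CC) \<noteq> UNIV" if Y: "Y \<in> YY" for Y
    proof
      assume eq: "span (Y \<union> \<Union>CC) = UNIV"
      \<comment> \<open>Once these finitely many vectors lie in \<open>span (Y \<union> N)\<close>,
        that span contains the generators and is preserved by the operators, which map
        \<open>Y\<close> into it and \<open>N\<close> into itself. So it is the whole space already
        for \<open>N\<close>.\<close>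
      have "finite (X \<union> (\<Union>i\<in>I. T i ` Y))"
        using finite_X finite_I YY[OF Y] by blast
      from common[OF this, of Y] eq
      obtain N where N: "N \<in> CC" and sub: "X \<union> (\<Union>i\<in>I. T i ` Y) \<subseteq> span (Y \<union> N)"
        by (metis subset_UNIV)
      have "span (Y \<union> N) = UNIV"
      proof (rule generated)
        show "X \<subseteq> span (Y \<union> N)" using sub by blast
        show "N0 \<subseteq> span (Y \<union> N)" using CC(1)[OF N] by (auto simp: stable_def intro: span_base)
        fix i v assume i: "i \<in> I" and v: "v \<in> span (Y \<union> N)"
        show "T i v \<in> span (Y \<union> N)"
          by (rule T_span_in[OF i _ _ v])
            (use sub i CC(1)[OF N] in \<open>auto simp: stable_def intro: span_base\<close>)
      qed auto
      then show False using CC(3)[OF N] Y by blast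
    qed
    then have "\<Union>CC \<in> AA" using U CC(2) False by (auto simp: AA_def)
    then show ?thesis by blast
  qed
  then have "\<exists>N\<in>AA. \<forall>N'\<in>AA. N \<subseteq> N' \<longrightarrow> N' = N"
    by (rule subset_Zorn)
  then obtain N where N: "N \<in> AA" and max: "\<And>N'. N' \<in> AA \<Longrightarrow> N \<subseteq> N' \<Longrightarrow> N' = N" by blast
  show thesis
  proof (rule that)
    show "stable N" "M \<subseteq> N" "\<And>Y. Y \<in> YY \<Longrightarrow> span (Y \<union> N) \<noteq> UNIV"
      using N by (auto simp: AA_def)
    fix N' assume "stable N'" "N \<subset> N'"
    then show "\<exists>Y\<in>YY. span (Y \<union> N') = UNIV"
      using max[of N'] N by (auto simp: AA_def)
  qed
qed

text \<open>There are countably many words in finitely many operators, hence countably many vectors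
  obtained by applying words to \<open>X\<close>.\<close>

lemma countably_spanned: "\<exists>C. countable C \<and> span (C \<union> N0) = UNIV"
proof (intro exI conjI)
  define C where "C = (\<lambda>(w, x). foldr T w x) ` (lists I \<times> X)"
  show "countable C"
    unfolding C_def using finite_I finite_X
    by (intro countable_image countable_SIGMA countable_lists) (auto intro: countable_finite)
  show "span (C \<union> N0) = UNIV"
  proof (rule generated)
    show "X \<subseteq> span (C \<union> N0)"
    proof
      fix x assume "x \<in> X"
      then have "(\<lambda>(w, x). foldr T w x) ([], x) \<in> C" unfolding C_def by (intro imageI) auto
      then show "x \<in> span (C \<union> N0)" by (auto intro: span_base)
    qed
    show "N0 \<subseteq> span (C \<union> N0)" by (auto intro: span_base)
    fix i v assume i: "i \<in> I" and v: "v \<in> span (C \<union> N0)"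
    show "T i v \<in> span (C \<union> N0)"
    proof (rule T_span_in[OF i _ _ v])
      fix a assume "a \<in> C \<union> N0"
      then show "T i a \<in> span (C \<union> N0)"
      proof
        assume "a \<in> C"
        then obtain w x where wx: "w \<in> lists I" "x \<in> X" "a = foldr T w x" by (auto simp: C_def)
        then have "(\<lambda>(w, x). foldr T w x) (i # w, x) \<in> C"
          unfolding C_def using i by (intro imageI) auto
        then show ?thesis using wx by (auto intro: span_base)
      qed (use T_N0[OF i] in \<open>auto intro: span_base\<close>)
    qed auto
  qed auto
qed

lemma endomorphism_stable_T:
  assumes "stable N" "i \<in> I"
  shows "endomorphism_stable scale (T i) N"
  using assms lin
  by (intro endomorphism_stable.intro endomorphism_stable_axioms.intro vector_space_axioms)
    (auto simp: stable_def)

lemma commute_shift: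
  assumes N: "stable N" and ij: "i \<in> I" "j \<in> I"
  shows "T j (T i v - a *s v) - (T i (T j v) - a *s T j v) \<in> N"
  using commute[OF ij(2,1), of v] N ij by (auto simp: stable_def T_simps algebra_simps)

text \<open>The set is the preimage of the kernel of \<open>T i - a\<close> on the quotient by
  \<open>N\<close>. It is a submodule because the operators commute modulo \<open>N\<close>.\<close>

lemma stable_shift_kernel:
  assumes N: "stable N" and i: "i \<in> I"
  shows "stable {v. T i v - a *s v \<in> N}" "N \<subseteq> {v. T i v - a *s v \<in> N}"
proof -
  have sN: "subspace N" and TN: "\<And>j v. j \<in> I \<Longrightarrow> v \<in> N \<Longrightarrow> T j v \<in> N" and "N0 \<subseteq> N"
    using N by (auto simp: stable_def)
  show sub: "N \<subseteq> {v. T i v - a *s v \<in> N}"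
    using TN[OF i] sN by (auto intro: subspace_diff subspace_scale)
  show "stable {v. T i v - a *s v \<in> N}"
    unfolding stable_def
  proof (intro conjI ballI subspaceI)
    show "0 \<in> {v. T i v - a *s v \<in> N}" using sub subspace_0[OF sN] by blast
    show "N0 \<subseteq> {v. T i v - a *s v \<in> N}" using sub \<open>N0 \<subseteq> N\<close> by blast
    show "x + y \<in> {v. T i v - a *s v \<in> N}"
      if "x \<in> {v. T i v - a *s v \<in> N}" "y \<in> {v. T i v - a *s v \<in> N}" for x y
      using subspace_add[OF sN, of "T i x - a *s x" "T i y - a *s y"] that i
      by (simp add: T_simps algebra_simps)
    show "c *s x \<in> {v. T i v - a *s v \<in> N}" if "x \<in> {v. T i v - a *s v \<in> N}" for c x
      using subspace_scale[OF sN, of "T i x - a *s x" c] that i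
      by (simp add: T_simps algebra_simps)
    fix j v assume j: "j \<in> I" and "v \<in> {v. T i v - a *s v \<in> N}"
    then have "T j (T i v - a *s v) \<in> N" using TN by blast
    from subspace_diff[OF sN this commute_shift[OF N i j, where a = a and v = v]]
    show "T j v \<in> {v. T i v - a *s v \<in> N}" by simp
  qed
qed

text \<open>The preimage, in the whole space, of the image of \<open>T i - a\<close> on the quotient
  by \<open>N\<close>.\<close>

definition shift_range :: "'b set \<Rightarrow> 'i \<Rightarrow> complex \<Rightarrow> 'b set" where
  "shift_range N i a = {m. \<exists>v. T i v - a *s v - m \<in> N}"

lemma stable_shift_range:
  assumes N: "stable N" and i: "i \<in> I"
  shows "stable (shift_range N i a)" "N \<subseteq> shift_range N i a" "T i v - a *s v \<in> shift_range N i a"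
proof -
  have sN: "subspace N" and TN: "\<And>j v. j \<in> I \<Longrightarrow> v \<in> N \<Longrightarrow> T j v \<in> N" and "N0 \<subseteq> N"
    using N by (auto simp: stable_def)
  show sub: "N \<subseteq> shift_range N i a"
  proof
    fix m assume "m \<in> N"
    then have "T i 0 - a *s 0 - m \<in> N" using i sN by (simp add: T_simps subspace_neg)
    then show "m \<in> shift_range N i a" unfolding shift_range_def by blast
  qed
  show "T i v - a *s v \<in> shift_range N i a"
    unfolding shift_range_def using subspace_0[OF sN] by (auto intro!: exI[of _ v])
  show "stable (shift_range N i a)"
    unfolding stable_def
  proof (intro conjI ballI subspaceI)
    show "0 \<in> shift_range N i a" using sub subspace_0[OF sN] by blast
    show "N0 \<subseteq> shift_range N i a" using sub \<open>N0 \<subseteq> N\<close> by blast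
    fix x assume "x \<in> shift_range N i a"
    then obtain u where u: "T i u - a *s u - x \<in> N" by (auto simp: shift_range_def)
    show "x + y \<in> shift_range N i a" if y: "y \<in> shift_range N i a" for y
    proof -
      obtain w where w: "T i w - a *s w - y \<in> N" using y by (auto simp: shift_range_def)
      have "T i (u + w) - a *s (u + w) - (x + y) \<in> N"
        using subspace_add[OF sN u w] i by (simp add: T_simps algebra_simps)
      then show ?thesis unfolding shift_range_def by blast
    qed
    show "c *s x \<in> shift_range N i a" for c
    proof -
      have "T i (c *s u) - a *s (c *s u) - c *s x \<in> N"
        using subspace_scale[OF sN u, of c] i by (simp add: T_simps algebra_simps)
      then show ?thesis unfolding shift_range_def by blast
    qed
    show "T j x \<in> shift_range N i a" if j: "j \<in> I" for j
    proof -
      \<comment> \<open>If \<open>u\<close> is a preimage of \<open>x\<close> under the shift, then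
        \<open>T j u\<close> is one of \<open>T j x\<close>, up to a commutator term that lies in
        \<open>N\<close>.\<close>
      have "T i (T j u) - a *s T j u - T j x
          = T j (T i u - a *s u - x) - (T j (T i u - a *s u) - (T i (T j u) - a *s T j u))"
        using i j by (simp add: T_simps algebra_simps)
      also have "\<dots> \<in> N"
        by (rule subspace_diff[OF sN TN[OF j u] commute_shift[OF N i j]])
      finally show ?thesis unfolding shift_range_def by blast
    qed
  qed
qed

lemma shift_range_eqD:
  assumes "stable N" "i \<in> I" "shift_range N i a = N"
  shows "{v. T i v - a *s v \<in> N} = UNIV"
  using stable_shift_range(3)[OF assms(1,2)] assms(3) by auto

text \<open>Amitsur's trick: an operator all of whose shifts are injective modulo \<open>N\<close> cannot have them all
  surjective, because the space has countable dimension and \<open>\<complex>\<close> is uncountable.\<close>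

lemma infinitely_many_nonsurjective_shifts:
  assumes N: "stable N" "N \<noteq> UNIV" and i: "i \<in> I"
    and inj: "\<And>a. {v. T i v - a *s v \<in> N} = N"
  shows "infinite {a. shift_range N i a \<noteq> UNIV}"
proof
  assume fin: "finite {a. shift_range N i a \<noteq> UNIV}"
  interpret endomorphism_stable scale "T i" N
    by (rule endomorphism_stable_T) fact+
  obtain C where C: "countable C" "span (C \<union> N0) = UNIV"
    using countably_spanned by blast
  have "N0 \<subseteq> N" using assms(1) by (simp add: stable_def)
  then have "span (C \<union> N0) \<subseteq> span (C \<union> N)"
    by (intro span_mono Un_mono subset_refl)
  then have "countable {a. \<forall>m. \<exists>v. T i v - a *s v - m \<in> N}"
    using inj C assms(2) by (intro countably_many_surjective_shifts[of C]) auto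
  then have "countable ({a. shift_range N i a \<noteq> UNIV} \<union> {a. \<forall>m. \<exists>v. T i v - a *s v - m \<in> N})"
    using fin by (intro countable_Un) (auto intro: countable_finite)
  moreover have "{a. shift_range N i a \<noteq> UNIV} \<union> {a. \<forall>m. \<exists>v. T i v - a *s v - m \<in> N} = UNIV"
    by (auto simp: shift_range_def)
  ultimately show False using uncountable_UNIV_complex by simp
qed

text \<open>A weak Nullstellensatz by countability. Above \<open>M\<close> there is a maximal proper
  stable \<open>N\<close>. If no shift of \<open>T i\<close> were zero modulo \<open>N\<close>,
  maximality would make all of them injective and surjective, contrary to
  \<open>infinitely_many_nonsurjective_shifts\<close>. So every \<open>T i\<close> is a scalar
  modulo \<open>N\<close>, every subspace above \<open>N\<close> is stable, and maximality makes the
  quotient a line; its coordinate is the functional.\<close>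

lemma eigenfunctional_exists:
  assumes "stable M" "M \<noteq> UNIV"
  shows "\<exists>\<phi>. Vector_Spaces.linear scale (*) \<phi> \<and> (\<forall>v\<in>M. \<phi> v = 0) \<and> (\<exists>v. \<phi> v \<noteq> 0) \<and>
    (\<forall>i\<in>I. \<exists>a. \<forall>v. \<phi> (T i v) = a * \<phi> v)"
proof -
  have span_eq: "span N = N" if "stable N" for N
    using that by (simp add: stable_def span_eq_iff)
  obtain N where N: "stable N" "M \<subseteq> N" "N \<noteq> UNIV"
    and max: "\<And>N'. stable N' \<Longrightarrow> N \<subset> N' \<Longrightarrow> N' = UNIV"
    using maximal_stable_avoiding[of "{{}}" M] assms span_eq by auto
  have sN: "subspace N" using N by (simp add: stable_def)
  have "\<exists>a. {v. T i v - a *s v \<in> N} = UNIV" if i: "i \<in> I" for i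
  proof (rule ccontr)
    assume *: "\<nexists>a. {v. T i v - a *s v \<in> N} = UNIV"
    have "{v. T i v - a *s v \<in> N} = N" for a
      using * stable_shift_kernel[OF N(1) i, of a] max by blast
    moreover have "shift_range N i a = UNIV" for a
      using * shift_range_eqD[OF N(1) i, of a] stable_shift_range(1,2)[OF N(1) i, of a] max by blast
    ultimately show False
      using infinitely_many_nonsurjective_shifts[OF N(1,3) i] by simp
  qed
  then obtain e where e: "\<And>i v. i \<in> I \<Longrightarrow> T i v - e i *s v \<in> N" by (metis UNIV_I mem_Collect_eq)
  obtain x where x: "x \<notin> N" using N by blast
  have "stable (span (insert x N))"
    unfolding stable_def
  proof (intro conjI ballI)
    show "N0 \<subseteq> span (insert x N)" using N(1) by (auto simp: stable_def intro: span_base)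
    fix i v assume i: "i \<in> I" and v: "v \<in> span (insert x N)"
    have "T i v = (T i v - e i *s v) + e i *s v" by simp
    also have "\<dots> \<in> span (insert x N)"
      using e[OF i, of v] by (intro span_add span_scale v) (auto intro: span_base)
    finally show "T i v \<in> span (insert x N)" .
  qed auto
  moreover have "N \<subset> span (insert x N)" using x by (auto intro: span_base)
  ultimately have all: "span (insert x N) = UNIV" using max by blast
  have ex: "\<exists>c. v - c *s x \<in> N" for v
    using all span_breakdown_eq[of v x N] span_eq[OF N(1)] by auto
  have uniq: "c = d" if "v - c *s x \<in> N" "v - d *s x \<in> N" for c d v
  proof (rule ccontr)
    assume "c \<noteq> d"
    have "(d - c) *s x \<in> N"
      using subspace_diff[OF sN that] by (simp add: scale_left_diff_distrib)
    from subspace_scale[OF sN this, of "inverse (d - c)"] show False using x \<open>c \<noteq> d\<close> by simp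
  qed
  obtain \<phi> where \<phi>: "\<And>v. v - \<phi> v *s x \<in> N" using ex by metis
  have \<phi>_eq: "\<phi> v = c" if "v - c *s x \<in> N" for v c using uniq \<phi> that by blast
  have \<phi>_N: "\<phi> v = 0" if "v \<in> N" for v using that by (intro \<phi>_eq) simp
  have add: "\<phi> (u + v) = \<phi> u + \<phi> v" for u v
    using subspace_add[OF sN \<phi> \<phi>, of u v] by (intro \<phi>_eq) (simp add: algebra_simps)
  have scale: "\<phi> (c *s v) = c * \<phi> v" for c v
    using subspace_scale[OF sN \<phi>, of c v] by (intro \<phi>_eq) (simp add: algebra_simps)
  show ?thesis
  proof (intro exI[of _ \<phi>] conjI ballI)
    show "Vector_Spaces.linear scale (*) \<phi>"
      by unfold_locales (auto simp: add scale algebra_simps)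
    show "\<phi> v = 0" if "v \<in> M" for v using \<phi>_N N(2) that by blast
    have "\<phi> x = 1" by (rule \<phi>_eq) (simp add: subspace_0[OF sN])
    then show "\<exists>v. \<phi> v \<noteq> 0" by (metis zero_neq_one)
    fix i assume i: "i \<in> I"
    have "\<phi> (T i v) = e i * \<phi> v" for v
      using add[of "T i v - e i *s v" "e i *s v"] \<phi>_N[OF e[OF i, of v]] by (simp add: scale)
    then show "\<exists>a. \<forall>v. \<phi> (T i v) = a * \<phi> v" by blast
  qed
qed

text \<open>Passing to a stable subspace \<open>N\<close> that is maximal among those of infinite codimension, every
  shift \<open>T i - a\<close> becomes zero or injective modulo \<open>N\<close>, and some \<open>T i\<close> is not a scalar.\<close>

lemma infinitely_many_eigenvalues:
  assumes inf: "\<And>Y. finite Y \<Longrightarrow> span (Y \<union> N0) \<noteq> UNIV"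
  shows "\<exists>i\<in>I. infinite {a. \<exists>\<phi>. Vector_Spaces.linear scale (*) \<phi> \<and> (\<forall>v\<in>N0. \<phi> v = 0) \<and>
    (\<exists>v. \<phi> v \<noteq> 0) \<and> (\<forall>j\<in>I. \<exists>b. \<forall>v. \<phi> (T j v) = b * \<phi> v) \<and> (\<forall>v. \<phi> (T i v) = a * \<phi> v)}"
proof -
  obtain N where N: "stable N" and infN: "\<And>Y. finite Y \<Longrightarrow> span (Y \<union> N) \<noteq> UNIV"
    and max: "\<And>N'. stable N' \<Longrightarrow> N \<subset> N' \<Longrightarrow> \<exists>Y. finite Y \<and> span (Y \<union> N') = UNIV"
    using maximal_stable_avoiding[of "Collect finite" N0] inf stable_N0
    by (metis mem_Collect_eq)
  have sN: "subspace N" and TN: "\<And>j v. j \<in> I \<Longrightarrow> v \<in> N \<Longrightarrow> T j v \<in> N" and "N0 \<subseteq> N"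
    using N by (auto simp: stable_def)
  \<comment> \<open>If the shift is neither zero nor injective modulo \<open>N\<close>, maximality
    gives its kernel \<open>K\<close> and its range \<open>R\<close> finite codimension. A finite
    set spanning modulo \<open>K\<close> is mapped to one spanning \<open>R\<close> modulo
    \<open>N\<close>; with a finite set spanning modulo \<open>R\<close> it would give
    \<open>N\<close> finite codimension.\<close>
  have dichotomy: "{v. T i v - a *s v \<in> N} = N \<or> {v. T i v - a *s v \<in> N} = UNIV"
    if i: "i \<in> I" for i a
  proof (rule ccontr)
    define K where "K = {v. T i v - a *s v \<in> N}"
    define R where "R = shift_range N i a"
    assume "\<not> ?thesis"
    then have K: "N \<subset> K" "K \<noteq> UNIV" using stable_shift_kernel(2)[OF N i, of a] by (auto simp: K_def)
    then have "N \<subset> R"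
      using shift_range_eqD[OF N i, of a] stable_shift_range(2)[OF N i, of a] by (auto simp: K_def R_def)
    obtain Y where Y: "finite Y" "span (Y \<union> K) = UNIV"
      using max[of K] stable_shift_kernel(1)[OF N i, of a] K by (auto simp: K_def)
    obtain Z where Z: "finite Z" "span (Z \<union> R) = UNIV"
      using max[of R] stable_shift_range(1)[OF N i, of a] \<open>N \<subset> R\<close> by (auto simp: R_def)
    define Y' where "Y' = (\<lambda>v. T i v - a *s v) ` Y"
    have img: "T i v - a *s v \<in> span (Y' \<union> N)" for v
    proof -
      have "v \<in> span (Y \<union> K)" using Y by simp
      then show ?thesis
      proof (induction rule: span_induct_alt)
        case base
        then show ?case using i by (simp add: T_simps span_zero)
      next
        case (step c x y)
        have "T i x - a *s x \<in> span (Y' \<union> N)"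
          using step(1) by (auto simp: Y'_def K_def intro: span_base)
        then have "c *s (T i x - a *s x) + (T i y - a *s y) \<in> span (Y' \<union> N)"
          using step(2) by (intro span_add span_scale)
        then show ?case using i by (simp add: T_simps algebra_simps)
      qed
    qed
    have "R \<subseteq> span (Y' \<union> N)"
    proof
      fix m assume "m \<in> R"
      then obtain v where v: "T i v - a *s v - m \<in> N" by (auto simp: R_def shift_range_def)
      have "(T i v - a *s v) - (T i v - a *s v - m) \<in> span (Y' \<union> N)"
        by (rule span_diff[OF img span_base]) (use v in simp)
      then show "m \<in> span (Y' \<union> N)" by simp
    qed
    then have "Z \<union> R \<subseteq> span (Z \<union> Y' \<union> N)"
      using span_mono[of "Y' \<union> N" "Z \<union> Y' \<union> N"] by (auto intro: span_base)
    then have "span (Z \<union> R) \<subseteq> span (Z \<union> Y' \<union> N)"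
      by (intro span_minimal) auto
    then have "span (Z \<union> Y' \<union> N) = UNIV" using Z by auto
    moreover have "finite (Z \<union> Y')" using Y Z by (simp add: Y'_def)
    ultimately show False using infN by blast
  qed
  \<comment> \<open>Otherwise all operators are scalars modulo \<open>N\<close>, and the finite set
    \<open>X\<close> spans modulo \<open>N\<close>.\<close>
  have "\<exists>i\<in>I. \<forall>a. {v. T i v - a *s v \<in> N} \<noteq> UNIV"
  proof (rule ccontr)
    assume "\<not> ?thesis"
    then have "\<forall>i\<in>I. \<exists>a. \<forall>v. T i v - a *s v \<in> N" by blast
    then obtain e where e: "\<And>i v. i \<in> I \<Longrightarrow> T i v - e i *s v \<in> N" by metis
    have "span (X \<union> N) = UNIV"
    proof (rule generated)
      show "X \<subseteq> span (X \<union> N)" "N0 \<subseteq> span (X \<union> N)" using \<open>N0 \<subseteq> N\<close> by (auto intro: span_base)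
      fix i v assume i: "i \<in> I" and v: "v \<in> span (X \<union> N)"
      have "T i v = (T i v - e i *s v) + e i *s v" by simp
      also have "\<dots> \<in> span (X \<union> N)"
        using e[OF i, of v] by (intro span_add span_scale v) (auto intro: span_base)
      finally show "T i v \<in> span (X \<union> N)" .
    qed auto
    then show False using infN finite_X by blast
  qed
  then obtain i where i: "i \<in> I" and "\<And>a. {v. T i v - a *s v \<in> N} = N"
    using dichotomy by blast
  moreover have "N \<noteq> UNIV" using infN[of "{}"] span_superset[of N] by auto
  ultimately have "infinite {a. shift_range N i a \<noteq> UNIV}"
    using N by (intro infinitely_many_nonsurjective_shifts)
  moreover have "{a. shift_range N i a \<noteq> UNIV} \<subseteq> {a. \<exists>\<phi>. Vector_Spaces.linear scale (*) \<phi> \<and>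
    (\<forall>v\<in>N0. \<phi> v = 0) \<and> (\<exists>v. \<phi> v \<noteq> 0) \<and> (\<forall>j\<in>I. \<exists>b. \<forall>v. \<phi> (T j v) = b * \<phi> v) \<and>
    (\<forall>v. \<phi> (T i v) = a * \<phi> v)}"
  proof (intro subsetI CollectI)
    fix a assume "a \<in> {a. shift_range N i a \<noteq> UNIV}"
    then obtain \<phi> where lin: "Vector_Spaces.linear scale (*) \<phi>"
      and zero: "\<forall>v\<in>shift_range N i a. \<phi> v = 0" and \<phi>: "\<exists>v. \<phi> v \<noteq> 0"
      "\<forall>i\<in>I. \<exists>a. \<forall>v. \<phi> (T i v) = a * \<phi> v"
      using eigenfunctional_exists[OF stable_shift_range(1)[OF N i, of a]] by auto
    interpret \<phi>: Vector_Spaces.linear scale "(*)" \<phi> by (fact lin)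
    have "\<phi> (T i v) = a * \<phi> v" for v
      using zero stable_shift_range(3)[OF N i, of v a] by (auto simp: \<phi>.diff \<phi>.scale)
    moreover have "\<forall>v\<in>N0. \<phi> v = 0"
      using zero stable_shift_range(2)[OF N i, of a] \<open>N0 \<subseteq> N\<close> by blast
    ultimately show "\<exists>\<phi>. Vector_Spaces.linear scale (*) \<phi> \<and> (\<forall>v\<in>N0. \<phi> v = 0) \<and>
      (\<exists>v. \<phi> v \<noteq> 0) \<and> (\<forall>j\<in>I. \<exists>b. \<forall>v. \<phi> (T j v) = b * \<phi> v) \<and> (\<forall>v. \<phi> (T i v) = a * \<phi> v)"
      using lin \<phi> by blast
  qed
  ultimately show ?thesis using i infinite_super by blast
qed

end

section \<open>Quotient vector spaces\<close>

lemma field_class_ring: "field (class_ring :: 'k::field ring)"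
  by (rule class_field.field_axioms)

text \<open>A common frame for \<open>group_homology1\<close> and \<open>tensor_rat\<close>. The
  scalar laws are required only modulo \<open>N\<close> because \<open>rat_scale\<close> distributes
  over sums of scalars only up to the relations of the tensor product.\<close>

locale quotient_space =
  fixes C N :: "'m::ab_group_add set" and sc :: "'k::field \<Rightarrow> 'm \<Rightarrow> 'm"
  assumes C_add: "x \<in> C \<Longrightarrow> y \<in> C \<Longrightarrow> x + y \<in> C" and C_minus: "x \<in> C \<Longrightarrow> - x \<in> C"
    and N_zero: "0 \<in> N" and N_add: "x \<in> N \<Longrightarrow> y \<in> N \<Longrightarrow> x + y \<in> N"
    and N_minus: "x \<in> N \<Longrightarrow> - x \<in> N" and N_sub: "N \<subseteq> C"
    and sc_C: "x \<in> C \<Longrightarrow> sc a x \<in> C" and sc_N: "x \<in> N \<Longrightarrow> sc a x \<in> N"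
    and sc_add: "x \<in> C \<Longrightarrow> y \<in> C \<Longrightarrow> sc a (x + y) - (sc a x + sc a y) \<in> N"
    and sc_plus: "x \<in> C \<Longrightarrow> sc (a + b) x - (sc a x + sc b x) \<in> N"
    and sc_mult: "x \<in> C \<Longrightarrow> sc (a * b) x - sc a (sc b x) \<in> N"
    and sc_one: "x \<in> C \<Longrightarrow> sc 1 x - x \<in> N"
begin

definition coset :: "'m \<Rightarrow> 'm set" where
  "coset x = (\<lambda>n. n + x) ` N"

text \<open>The record copies the shape of \<open>quotient_module\<close> and
  \<open>tensor_rat\<close>, so that both become equal to it and not merely isomorphic.\<close>

definition quotient :: "('k, 'm set) module" where
  "quotient = \<lparr>carrier = coset ` C, monoid.mult = undefined, one = undefined, zero = N,
     add = (\<lambda>X Y. \<Union>x\<in>X. \<Union>y\<in>Y. {x + y}), module.smult = (\<lambda>a X. \<Union>x\<in>X. coset (sc a x))\<rparr>"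

lemma N_diff: "x \<in> N \<Longrightarrow> y \<in> N \<Longrightarrow> x - y \<in> N"
  using N_add[OF _ N_minus, of x y] by simp

lemma mem_coset: "y \<in> coset x \<longleftrightarrow> y - x \<in> N"
  by (auto simp: coset_def image_iff intro: bexI[of _ "y - x"])

lemma coset_eq_iff: "coset x = coset y \<longleftrightarrow> x - y \<in> N"
proof
  assume "coset x = coset y"
  then show "x - y \<in> N" using mem_coset[of x x] mem_coset[of x y] N_zero by simp
next
  assume xy: "x - y \<in> N"
  show "coset x = coset y"
  proof (intro Set.set_eqI iffI)
    fix z
    show "z \<in> coset y" if "z \<in> coset x"
      using N_add[OF _ xy, of "z - x"] that by (simp add: mem_coset)
    show "z \<in> coset x" if "z \<in> coset y"
      using N_diff[OF _ xy, of "z - y"] that by (simp add: mem_coset)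
  qed
qed

lemma coset_zero: "coset 0 = N"
  by (simp add: coset_def)

lemma coset_eq_N_iff: "coset x = N \<longleftrightarrow> x \<in> N"
  using coset_eq_iff[of x 0] by (simp add: coset_zero)

lemma C_zero: "0 \<in> C"
  using N_zero N_sub by blast

lemma add_coset: "add quotient (coset x) (coset y) = coset (x + y)"
proof (intro Set.set_eqI iffI)
  fix z assume "z \<in> add quotient (coset x) (coset y)"
  then obtain u v where "u - x \<in> N" "v - y \<in> N" "z = u + v"
    by (auto simp: quotient_def mem_coset)
  then show "z \<in> coset (x + y)"
    using N_add[of "u - x" "v - y"] by (simp add: mem_coset algebra_simps)
next
  fix z assume "z \<in> coset (x + y)"
  then have "z - y \<in> coset x" "y \<in> coset y" using N_zero by (simp_all add: mem_coset algebra_simps)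
  then show "z \<in> add quotient (coset x) (coset y)"
    unfolding quotient_def by (simp, metis diff_add_cancel)
qed

lemma sc_cong:
  assumes "x \<in> C" "y \<in> C" "x - y \<in> N"
  shows "sc a x - sc a y \<in> N"
proof -
  have "sc a ((x - y) + y) - (sc a (x - y) + sc a y) \<in> N"
    using assms N_sub by (intro sc_add) auto
  from N_add[OF this sc_N[OF assms(3), of a]] show ?thesis by simp
qed

lemma smult_coset:
  assumes "x \<in> C"
  shows "a \<odot>\<^bsub>quotient\<^esub> coset x = coset (sc a x)"
proof -
  have "coset (sc a y) = coset (sc a x)" if "y \<in> coset x" for y
  proof -
    have "y - x \<in> N" using that by (simp add: mem_coset)
    then have "(y - x) + x \<in> C" using assms N_sub by (intro C_add) auto
    then show ?thesis using \<open>y - x \<in> N\<close> assms by (simp add: coset_eq_iff sc_cong)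
  qed
  moreover have "x \<in> coset x" using N_zero by (simp add: mem_coset)
  ultimately have "(\<Union>y\<in>coset x. coset (sc a y)) = coset (sc a x)"
    by (intro SUP_eq_const) blast+
  then show ?thesis by (simp add: quotient_def)
qed

lemma quotient_simps: "carrier quotient = coset ` C" "zero quotient = coset 0"
  by (simp_all add: quotient_def coset_zero)

lemma vectorspace_quotient: "vectorspace class_ring quotient"
proof (rule vs_criteria[OF field_class_ring], goal_cases)
  case 3
  show ?case
  proof
    fix v assume "v \<in> carrier quotient"
    then obtain x where "x \<in> C" "v = coset x" by (auto simp: quotient_simps)
    then show "\<exists>w\<in>carrier quotient. v \<oplus>\<^bsub>quotient\<^esub> w = \<zero>\<^bsub>quotient\<^esub>"
      by (auto simp: quotient_simps add_coset C_minus intro!: bexI[of _ "- x"])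
  qed
next
  case 5
  then show ?case by (clarsimp simp: quotient_simps add_coset add.commute)
qed (clarsimp simp: quotient_simps add_coset smult_coset C_zero C_add sc_C coset_eq_iff N_zero
    sc_add sc_plus sc_mult sc_one add.assoc intro!: imageI)+

interpretation V: vectorspace class_ring quotient
  by (rule vectorspace_quotient)

text \<open>Finite dimension is pulled back to an induction principle for subsets of
  \<open>C\<close>. Applications then choose a suitable \<open>W\<close> instead of handling linear
  combinations of cosets.\<close>

lemma fin_dim_iff:
  "vectorspace.fin_dim class_ring quotient \<longleftrightarrow> (\<exists>F. finite F \<and> F \<subseteq> C \<and>
     (\<forall>W. N \<subseteq> W \<longrightarrow> W \<subseteq> C \<longrightarrow> F \<subseteq> W \<longrightarrow> (\<forall>x\<in>W. \<forall>y\<in>W. x + y \<in> W) \<longrightarrow> (\<forall>a. \<forall>x\<in>W. sc a x \<in> W) \<longrightarrow> W = C))"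
  (is "_ \<longleftrightarrow> (\<exists>F. ?R F)")
proof
  assume "vectorspace.fin_dim class_ring quotient"
  then obtain A where A: "finite A" "A \<subseteq> coset ` C" "V.span A = coset ` C"
    by (auto simp: V.fin_dim_def quotient_simps)
  then obtain F where F: "F \<subseteq> C" "finite F" "A = coset ` F"
    using finite_subset_image by metis
  have "W = C" if W: "N \<subseteq> W" "W \<subseteq> C" "F \<subseteq> W" and add: "\<forall>x\<in>W. \<forall>y\<in>W. x + y \<in> W"
    and sc: "\<forall>a. \<forall>x\<in>W. sc a x \<in> W" for W
  proof -
    have "submodule class_ring (coset ` W) quotient"
    proof (rule submodule.intro)
      show "Module.module class_ring quotient" ..
      show "coset ` W \<subseteq> carrier quotient" using W by (auto simp: quotient_simps)
      show "\<zero>\<^bsub>quotient\<^esub> \<in> coset ` W" using W N_zero by (auto simp: quotient_simps)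
      show "v \<oplus>\<^bsub>quotient\<^esub> w \<in> coset ` W" if "v \<in> coset ` W" "w \<in> coset ` W" for v w
        using that add by (auto simp: add_coset)
      show "c \<odot>\<^bsub>quotient\<^esub> v \<in> coset ` W" if "v \<in> coset ` W" for c v
        using that sc W by (auto simp: smult_coset subset_iff)
    qed
    then have "V.span A \<subseteq> coset ` W"
      using F W by (intro V.span_is_subset) auto
    then have sub: "coset ` C \<subseteq> coset ` W" using A by simp
    have "x \<in> W" if "x \<in> C" for x
    proof -
      have "coset x \<in> coset ` W" using that sub by blast
      then obtain y where "y \<in> W" "x - y \<in> N" using coset_eq_iff by blast
      then have "(x - y) + y \<in> W" using W add by blast
      then show ?thesis by simp
    qed
    then show ?thesis using W by blast
  qed
  then show "\<exists>F. ?R F" using F by blast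
next
  assume "\<exists>F. ?R F"
  then obtain F where F: "finite F" "F \<subseteq> C" and gen: "\<And>W. N \<subseteq> W \<Longrightarrow> W \<subseteq> C \<Longrightarrow> F \<subseteq> W \<Longrightarrow>
      \<forall>x\<in>W. \<forall>y\<in>W. x + y \<in> W \<Longrightarrow> \<forall>a. \<forall>x\<in>W. sc a x \<in> W \<Longrightarrow> W = C" by blast
  have AC: "coset ` F \<subseteq> carrier quotient" using F by (auto simp: quotient_simps)
  interpret S: submodule class_ring "V.span (coset ` F)" quotient
    using AC by (rule V.span_is_submodule)
  define W where "W = {x \<in> C. coset x \<in> V.span (coset ` F)}"
  have "W = C"
  proof (rule gen)
    show "N \<subseteq> W" using N_sub S.zero_closed by (auto simp: W_def quotient_def coset_eq_N_iff[THEN iffD2])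
    show "F \<subseteq> W" using F V.in_own_span[OF AC] by (auto simp: W_def)
    show "\<forall>x\<in>W. \<forall>y\<in>W. x + y \<in> W" using S.m_closed by (auto simp: W_def C_add simp flip: add_coset)
    show "\<forall>a. \<forall>x\<in>W. sc a x \<in> W"
      using S.smult_closed by (auto simp: W_def sc_C simp flip: smult_coset)
  qed (simp add: W_def)
  then have "V.span (coset ` F) = carrier quotient"
    using S.subset by (auto simp: quotient_simps W_def)
  then show "vectorspace.fin_dim class_ring quotient"
    unfolding V.fin_dim_def using F AC by blast
qed

text \<open>The zero quotient is spanned by the empty set, so it is finite-dimensional of dimension
  0. Any other quotient either has a nonempty basis or satisfies the guarded condition
  vacuously.\<close>

lemma dim_ge_1_iff:
  "(vectorspace.fin_dim class_ring quotient \<longrightarrow> 1 \<le> vectorspace.dim class_ring quotient) \<longleftrightarrow> C \<noteq> N"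
proof -
  have span_empty: "V.span {} = {N}"
    by (auto simp: V.span_def V.lincomb_def quotient_simps coset_zero)
  show ?thesis
  proof
    assume *: "V.fin_dim \<longrightarrow> 1 \<le> V.dim"
    show "C \<noteq> N"
    proof
      assume "C = N"
      have "coset ` C = (\<lambda>_. N) ` C"
        using \<open>C = N\<close> by (intro image_cong) (simp_all add: coset_eq_N_iff)
      also have "\<dots> = {N}" using C_zero by auto
      finally have "carrier quotient = {N}" by (simp only: quotient_simps)
      then have "V.gen_set {}" using span_empty by simp
      then have "V.fin_dim" "V.dim \<le> card ({} :: 'm set set)"
        by (auto simp only: V.fin_dim_def intro!: exI[of _ "{}"] V.gen_ge_dim)
      then show False using * by simp
    qed
  next
    assume "C \<noteq> N"
    show "V.fin_dim \<longrightarrow> 1 \<le> V.dim"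
    proof (intro impI, rule ccontr)
      assume fd: "V.fin_dim" and "\<not> 1 \<le> V.dim"
      then have "V.dim = 0" by simp
      obtain A where "finite A" "V.basis A" using V.finite_basis_exists[OF fd] by blast
      then have "A = {}" using V.dim_basis[of A] \<open>V.dim = 0\<close> by simp
      then have "coset ` C = {N}"
        using \<open>V.basis A\<close> span_empty by (simp add: V.basis_def quotient_simps)
      then have "C \<subseteq> N" using coset_eq_N_iff by blast
      then show False using \<open>C \<noteq> N\<close> N_sub by blast
    qed
  qed
qed

end

section \<open>First homology and eigenfunctions\<close>

text \<open>The summand sees the key together with its coefficient. This covers the bar
  differentials and \<open>conj_op\<close>, and later also a map that is additive only modulo
  relations.\<close>

definition pm_sum :: "('a \<Rightarrow> 'k \<Rightarrow> 'c) \<Rightarrow> ('a \<Rightarrow>\<^sub>0 'k::comm_monoid_add) \<Rightarrow> 'c::comm_monoid_add" where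
  "pm_sum h u = (\<Sum>x\<in>Poly_Mapping.keys u. h x (Poly_Mapping.lookup u x))"

lemma pm_sum_superset:
  assumes "finite A" "Poly_Mapping.keys u \<subseteq> A" "\<And>x. h x 0 = 0"
  shows "pm_sum h u = (\<Sum>x\<in>A. h x (Poly_Mapping.lookup u x))"
  unfolding pm_sum_def using assms
  by (intro sum.mono_neutral_left) (auto simp: in_keys_iff)

lemma pm_sum_add:
  assumes "\<And>x. h x 0 = 0" "\<And>x a b. h x (a + b) = h x a + h x b"
  shows "pm_sum h (u + v) = pm_sum h u + pm_sum h v"
proof -
  let ?A = "Poly_Mapping.keys u \<union> Poly_Mapping.keys v"
  have "finite ?A" by simp
  then show ?thesis
    using assms keys_add[of u v]
    by (simp add: pm_sum_superset[of ?A] lookup_add sum.distrib)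
qed

lemma pm_sum_0 [simp]: "pm_sum h 0 = 0"
  by (simp add: pm_sum_def)

lemma pm_sum_single: "h x 0 = 0 \<Longrightarrow> pm_sum h (Poly_Mapping.single x a) = h x a"
  by (cases "a = 0") (simp_all add: pm_sum_def)

abbreviation pm_scale :: "'k::field \<Rightarrow> ('a \<Rightarrow>\<^sub>0 'k) \<Rightarrow> 'a \<Rightarrow>\<^sub>0 'k" where
  "pm_scale a \<equiv> Poly_Mapping.map ((*) a)"

lemma lookup_pm_scale: "Poly_Mapping.lookup (pm_scale a u) x = a * Poly_Mapping.lookup u x"
  by (simp add: Poly_Mapping.map.rep_eq when_def)

lemma keys_pm_scale: "Poly_Mapping.keys (pm_scale a u) \<subseteq> Poly_Mapping.keys u"
  by (auto simp: in_keys_iff lookup_pm_scale)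

lemma pm_scale_single: "pm_scale a (Poly_Mapping.single x b) = Poly_Mapping.single x (a * b)"
  by (rule poly_mapping_eqI) (simp add: lookup_pm_scale lookup_single when_def)

interpretation pm: vector_space "pm_scale :: 'k::field \<Rightarrow> ('a \<Rightarrow>\<^sub>0 'k) \<Rightarrow> _"
  by unfold_locales (auto intro!: poly_mapping_eqI simp: lookup_pm_scale lookup_add algebra_simps)

lemma pm_sum_scale:
  assumes "\<And>x. h x 0 = 0"
  shows "pm_sum h (pm_scale a u) = pm_sum (\<lambda>x b. h x (a * b)) u"
  using assms keys_pm_scale[of a u]
  by (simp add: pm_sum_superset[of "Poly_Mapping.keys u"] lookup_pm_scale)

lemma pm_sum_singles: "u = (\<Sum>x\<in>Poly_Mapping.keys u. Poly_Mapping.single x (Poly_Mapping.lookup u x))"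
proof (rule poly_mapping_eqI)
  fix y
  have "(\<Sum>x\<in>Poly_Mapping.keys u. Poly_Mapping.lookup (Poly_Mapping.single x (Poly_Mapping.lookup u x)) y)
      = (\<Sum>x\<in>Poly_Mapping.keys u. if x = y then Poly_Mapping.lookup u x else 0)"
    by (intro sum.cong) (auto simp: lookup_single when_def)
  then show "Poly_Mapping.lookup u y
      = Poly_Mapping.lookup (\<Sum>x\<in>Poly_Mapping.keys u. Poly_Mapping.single x (Poly_Mapping.lookup u x)) y"
    by (simp add: lookup_sum in_keys_iff)
qed

lemma pm_linear_eq_sum:
  assumes "Vector_Spaces.linear pm_scale (*) \<psi>"
  shows "\<psi> u = (\<Sum>x\<in>Poly_Mapping.keys u. Poly_Mapping.lookup u x * \<psi> (Poly_Mapping.single x 1))"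
proof -
  interpret \<psi>: Vector_Spaces.linear pm_scale "(*)" \<psi> by (fact assms)
  have "\<psi> u = (\<Sum>x\<in>Poly_Mapping.keys u. \<psi> (pm_scale (Poly_Mapping.lookup u x) (Poly_Mapping.single x 1)))"
    by (subst pm_sum_singles[of u]) (simp add: \<psi>.sum pm_scale_single)
  then show ?thesis by (simp only: \<psi>.scale)
qed

lemma (in vector_space) separating_functional:
  assumes "subspace S" "c \<notin> S"
  obtains \<phi> where "Vector_Spaces.linear scale (*) \<phi>" "\<And>v. v \<in> S \<Longrightarrow> \<phi> v = 0" "\<phi> c = 1"
proof -
  interpret k: vector_space "(*) :: 'a \<Rightarrow> 'a \<Rightarrow> 'a"
    by unfold_locales (auto simp: algebra_simps)
  interpret p: vector_space_pair scale "(*) :: 'a \<Rightarrow> 'a \<Rightarrow> 'a"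
    by unfold_locales
  obtain B where B: "B \<subseteq> S" "independent B" "S \<subseteq> span B"
    using maximal_independent_subset by blast
  then have "span B = S"
    using assms(1) by (metis span_minimal subset_antisym)
  then have "independent (insert c B)"
    using assms(2) B by (intro independent_insertI) auto
  then obtain \<phi> where lin: "Vector_Spaces.linear scale (*) \<phi>"
    and \<phi>: "\<forall>x\<in>insert c B. \<phi> x = (if x = c then 1 else 0)"
    using p.linear_independent_extend[where f = "\<lambda>x. if x = c then 1 else 0"] by blast
  have "\<phi> v = 0" if "v \<in> S" for v
  proof (rule p.linear_eq_0_on_span[OF lin, of B])
    show "\<phi> x = 0" if "x \<in> B" for x using \<phi> that assms(2) B(1) by auto
  qed (use that B in blast)
  then show thesis using \<phi> by (intro that[OF lin]) auto
qed

section \<open>Commutators, characters and the twisted bar complex\<close>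

context group
begin

abbreviation G' :: "'a set" where "G' \<equiv> derived G (carrier G)"

definition comm :: "'a \<Rightarrow> 'a \<Rightarrow> 'a" where
  "comm g h = g \<otimes> h \<otimes> inv g \<otimes> inv h"

lemma derived_subgroup: "subgroup G' G"
  by (rule derived_is_subgroup) simp

lemma derived_closed [simp]: "x \<in> G' \<Longrightarrow> x \<in> carrier G"
  using derived_subgroup subgroup.mem_carrier by metis

lemma comm_closed [simp]: "g \<in> carrier G \<Longrightarrow> h \<in> carrier G \<Longrightarrow> comm g h \<in> carrier G"
  by (simp add: comm_def)

lemma comm_in_derived: "g \<in> carrier G \<Longrightarrow> h \<in> carrier G \<Longrightarrow> comm g h \<in> G'"
  unfolding derived_def comm_def by (rule generate.incl) auto

lemma derived_least:
  assumes "subgroup H G" "\<And>g h. g \<in> carrier G \<Longrightarrow> h \<in> carrier G \<Longrightarrow> comm g h \<in> H"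
  shows "G' \<subseteq> H"
  unfolding derived_def using assms by (intro generate_subgroup_incl) (auto simp: comm_def)

lemma derived_conj: "g \<in> carrier G \<Longrightarrow> x \<in> G' \<Longrightarrow> g \<otimes> x \<otimes> inv g \<in> G'"
  using normal.inv_op_closed2[OF derived_self_is_normal] by simp

lemma cancel_inv:
  assumes "x \<in> carrier G" "y \<in> carrier G"
  shows "x \<otimes> (inv x \<otimes> y) = y" "inv x \<otimes> (x \<otimes> y) = y"
  using assms by (simp_all flip: m_assoc)

text \<open>For fixed \<open>k\<close> this makes \<open>g \<mapsto> comm g k\<close> a crossed
  homomorphism into \<open>G'\<close>. It is used both to extend eigenfunctions to \<open>G\<close>
  and to generate \<open>G'\<close> from commutators of generators.\<close>

lemma comm_mult_left:
  assumes "g \<in> carrier G" "h \<in> carrier G" "k \<in> carrier G"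
  shows "comm (g \<otimes> h) k = (g \<otimes> comm h k \<otimes> inv g) \<otimes> comm g k"
  using assms by (simp add: comm_def m_assoc inv_mult_group cancel_inv)

lemma comm_swap:
  assumes "g \<in> carrier G" "h \<in> carrier G"
  shows "comm g h \<otimes> (h \<otimes> g) = g \<otimes> h"
  using assms by (simp add: comm_def m_assoc cancel_inv)

lemma character_mult:
  assumes "\<rho> \<in> character_group G" "g \<in> carrier G" "h \<in> carrier G"
  shows "\<rho> (g \<otimes> h) = \<rho> g * \<rho> h"
  using assms by (auto simp: character_group_def hom_def units_of_def)

lemma character_nonzero:
  assumes "\<rho> \<in> character_group G" "g \<in> carrier G"
  shows "\<rho> g \<noteq> 0"
  using assms by (auto simp: character_group_def hom_def units_of_def Units_def Pi_iff)

lemma character_one: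
  assumes "\<rho> \<in> character_group G"
  shows "\<rho> \<one> = 1"
  using character_mult[OF assms, of \<one> \<one>] character_nonzero[OF assms, of \<one>] by simp

lemma character_inv:
  assumes "\<rho> \<in> character_group G" "g \<in> carrier G"
  shows "\<rho> (inv g) = inverse (\<rho> g)"
  using character_mult[OF assms(1), of g "inv g"] character_one[OF assms(1)] assms
  by (simp add: inverse_unique)

lemma character_derived:
  assumes \<rho>: "\<rho> \<in> character_group G" and "x \<in> G'"
  shows "\<rho> x = 1"
proof -
  have "G' \<subseteq> {x \<in> carrier G. \<rho> x = 1}"
  proof (rule derived_least)
    show "subgroup {x \<in> carrier G. \<rho> x = 1} G"
      by (rule subgroupI) (use character_one[OF \<rho>] in \<open>auto simp: character_mult \<rho> character_inv\<close>)
    show "comm g h \<in> {x \<in> carrier G. \<rho> x = 1}" if "g \<in> carrier G" "h \<in> carrier G" for g h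
      using that character_nonzero[OF \<rho> that(1)] character_nonzero[OF \<rho> that(2)]
      by (simp add: comm_def character_mult \<rho> character_inv field_simps)
  qed
  then show ?thesis using assms by blast
qed

text \<open>The value 0 outside \<open>G'\<close> makes the function determined by its restriction
  to \<open>G'\<close>, so functions on \<open>G'\<close> can be compared as functions on the whole
  type.\<close>

definition derived_additive :: "('a \<Rightarrow> 'k::comm_ring_1) \<Rightarrow> bool" where
  "derived_additive f \<longleftrightarrow> (\<forall>x\<in>G'. \<forall>y\<in>G'. f (x \<otimes> y) = f x + f y) \<and> (\<forall>x. x \<notin> G' \<longrightarrow> f x = 0)"

lemma derived_additive_simps:
  assumes f: "derived_additive f"
  shows "x \<in> G' \<Longrightarrow> y \<in> G' \<Longrightarrow> f (x \<otimes> y) = f x + f y" "f \<one> = 0"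
    "x \<in> G' \<Longrightarrow> f (inv x) = - f x" "x \<notin> G' \<Longrightarrow> f x = 0"
proof -
  show *: "f (x \<otimes> y) = f x + f y" if "x \<in> G'" "y \<in> G'" for x y
    using that f by (auto simp: derived_additive_def)
  have one: "\<one> \<in> G'" using derived_subgroup by (rule subgroup.one_closed)
  show "f \<one> = 0" using *[OF one one] by simp
  show "f (inv x) = - f x" if "x \<in> G'"
    using *[of x "inv x"] that subgroup.m_inv_closed[OF derived_subgroup that] \<open>f \<one> = 0\<close>
    by (simp add: eq_neg_iff_add_eq_0 add.commute)
  show "x \<notin> G' \<Longrightarrow> f x = 0" using f by (auto simp: derived_additive_def)
qed

definition eigenfunction :: "('a \<Rightarrow> complex) \<Rightarrow> ('a \<Rightarrow> complex) \<Rightarrow> bool" where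
  "eigenfunction \<rho> f \<longleftrightarrow> derived_additive f \<and> (\<exists>x. f x \<noteq> 0) \<and>
     (\<forall>g\<in>carrier G. \<forall>x\<in>G'. f x = \<rho> g * f (g \<otimes> x \<otimes> inv g))"

definition cycles :: "('a \<Rightarrow> complex) \<Rightarrow> ('a \<Rightarrow>\<^sub>0 complex) set" where
  "cycles \<rho> = {c. Poly_Mapping.keys c \<subseteq> carrier G \<and> pm_sum (\<lambda>g a. a - \<rho> g * a) c = 0}"

definition boundary :: "('a \<Rightarrow> complex) \<Rightarrow> 'a \<times> 'a \<Rightarrow> complex \<Rightarrow> 'a \<Rightarrow>\<^sub>0 complex" where
  "boundary \<rho> p a = Poly_Mapping.single (snd p) a - Poly_Mapping.single (fst p \<otimes> snd p) a
     + Poly_Mapping.single (fst p) (\<rho> (snd p) * a)"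

definition boundaries :: "('a \<Rightarrow> complex) \<Rightarrow> ('a \<Rightarrow>\<^sub>0 complex) set" where
  "boundaries \<rho> = pm_sum (boundary \<rho>) ` {c. Poly_Mapping.keys c \<subseteq> carrier G \<times> carrier G}"

lemma boundary_0: "boundary \<rho> p 0 = 0"
  by (simp add: boundary_def)

lemma boundary_add: "boundary \<rho> p (a + b) = boundary \<rho> p a + boundary \<rho> p b"
  by (simp add: boundary_def single_add distrib_left)

lemma boundary_scale: "boundary \<rho> p (a * b) = pm_scale a (boundary \<rho> p b)"
  by (simp add: boundary_def pm.scale_right_distrib pm.scale_right_diff_distrib pm_scale_single
      mult.left_commute)

lemma subspace_cycles: "pm.subspace (cycles \<rho>)"
proof (rule pm.subspaceI)
  show "0 \<in> cycles \<rho>" by (simp add: cycles_def)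
  show "u + v \<in> cycles \<rho>" if "u \<in> cycles \<rho>" "v \<in> cycles \<rho>" for u v
    using that keys_add[of u v] by (auto simp: cycles_def pm_sum_add algebra_simps)
  show "pm_scale a u \<in> cycles \<rho>" if u: "u \<in> cycles \<rho>" for a u
  proof -
    have "pm_sum (\<lambda>g b. a * b - \<rho> g * (a * b)) u = a * pm_sum (\<lambda>g b. b - \<rho> g * b) u"
      by (simp add: pm_sum_def sum_distrib_left algebra_simps)
    then show ?thesis using u keys_pm_scale[of a u] by (auto simp: cycles_def pm_sum_scale)
  qed
qed

lemma subspace_boundaries: "pm.subspace (boundaries \<rho>)"
proof (rule pm.subspaceI)
  show "0 \<in> boundaries \<rho>" unfolding boundaries_def by (rule image_eqI[of _ _ 0]) auto
  show "u + v \<in> boundaries \<rho>" if uv: "u \<in> boundaries \<rho>" "v \<in> boundaries \<rho>" for u v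
  proof -
    obtain c d where "Poly_Mapping.keys c \<subseteq> carrier G \<times> carrier G" "u = pm_sum (boundary \<rho>) c"
      "Poly_Mapping.keys d \<subseteq> carrier G \<times> carrier G" "v = pm_sum (boundary \<rho>) d"
      using uv by (auto simp: boundaries_def)
    then show ?thesis
      unfolding boundaries_def using keys_add[of c d]
      by (intro image_eqI[of _ _ "c + d"]) (auto simp: pm_sum_add boundary_0 boundary_add)
  qed
  show "pm_scale a u \<in> boundaries \<rho>" if u: "u \<in> boundaries \<rho>" for a u
  proof -
    obtain c where c: "Poly_Mapping.keys c \<subseteq> carrier G \<times> carrier G" "u = pm_sum (boundary \<rho>) c"
      using u by (auto simp: boundaries_def)
    have "pm_sum (boundary \<rho>) (pm_scale a c) = pm_scale a u"
      unfolding c by (simp add: pm_sum_scale boundary_0 boundary_scale) (simp add: pm_sum_def pm.scale_sum_right)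
    then show ?thesis
      unfolding boundaries_def using c keys_pm_scale[of a c]
      by (intro image_eqI[of _ _ "pm_scale a c"]) auto
  qed
qed

lemma boundaries_least:
  assumes "pm.subspace W"
    and "\<And>g h a. g \<in> carrier G \<Longrightarrow> h \<in> carrier G \<Longrightarrow> boundary \<rho> (g, h) a \<in> W"
  shows "boundaries \<rho> \<subseteq> W"
proof -
  have "pm_sum (boundary \<rho>) c \<in> W" if "Poly_Mapping.keys c \<subseteq> carrier G \<times> carrier G" for c
    unfolding pm_sum_def
  proof (rule pm.subspace_sum[OF assms(1)])
    fix p assume "p \<in> Poly_Mapping.keys c"
    then show "boundary \<rho> p (Poly_Mapping.lookup c p) \<in> W"
      using that assms(2)[of "fst p" "snd p"] by auto
  qed
  then show ?thesis by (auto simp: boundaries_def)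
qed

lemma boundary_in_boundaries:
  assumes "g \<in> carrier G" "h \<in> carrier G"
  shows "boundary \<rho> (g, h) a \<in> boundaries \<rho>"
  unfolding boundaries_def
  using assms by (intro image_eqI[of _ _ "Poly_Mapping.single (g, h) a"]) (auto simp: pm_sum_single boundary_0)

lemma boundaries_sub_cycles:
  assumes "\<rho> \<in> character_group G"
  shows "boundaries \<rho> \<subseteq> cycles \<rho>"
proof (rule boundaries_least[OF subspace_cycles])
  fix g h a assume gh: "g \<in> carrier G" "h \<in> carrier G"
  have add: "pm_sum (\<lambda>g a. a - \<rho> g * a) (u + v)
      = pm_sum (\<lambda>g a. a - \<rho> g * a) u + pm_sum (\<lambda>g a. a - \<rho> g * a) v" for u v
    by (rule pm_sum_add) (simp_all add: algebra_simps)
  have *: "boundary \<rho> (g, h) a = Poly_Mapping.single h a + Poly_Mapping.single (g \<otimes> h) (- a)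
      + Poly_Mapping.single g (\<rho> h * a)"
    by (simp add: boundary_def single_uminus)
  have "Poly_Mapping.keys (boundary \<rho> (g, h) a) \<subseteq> {h, g \<otimes> h, g}"
    unfolding boundary_def by (auto simp: in_keys_iff lookup_add lookup_minus lookup_single when_def
        split: if_splits)
  moreover have "pm_sum (\<lambda>g a. a - \<rho> g * a) (boundary \<rho> (g, h) a) = 0"
    unfolding * using gh by (simp only: add) (simp add: pm_sum_single character_mult[OF assms] algebra_simps)
  ultimately show "boundary \<rho> (g, h) a \<in> cycles \<rho>" using gh by (auto simp: cycles_def)
qed

lemma quotient_space_homology:
  assumes "\<rho> \<in> character_group G"
  shows "quotient_space (cycles \<rho>) (boundaries \<rho>) pm_scale"
  using boundaries_sub_cycles[OF assms]
  by unfold_locales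
    (auto simp: pm.subspace_add pm.subspace_neg pm.subspace_0 pm.subspace_scale subspace_cycles
      subspace_boundaries pm.scale_right_distrib pm.scale_left_distrib)

lemma group_homology1_eq_quotient:
  assumes "\<rho> \<in> character_group G"
  shows "group_homology1 G (character_action \<rho>)
    = quotient_space.quotient (cycles \<rho>) (boundaries \<rho>) pm_scale"
proof -
  have c: "carrier (bar_cycles1 G (character_action \<rho>)) = cycles \<rho>"
    by (simp add: bar_cycles1_def cycles_def bar_d1_def pm_sum_def character_action_def)
  have d2: "bar_d2 G (character_action \<rho>) = pm_sum (boundary \<rho>)"
    by (rule ext) (simp add: bar_d2_def pm_sum_def boundary_def character_action_def Let_def
        case_prod_unfold)
  have b: "bar_boundaries1 G (character_action \<rho>) = boundaries \<rho>"
    by (simp add: bar_boundaries1_def boundaries_def d2)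
  have ops: "add (bar_cycles1 G (character_action \<rho>)) = (+)"
    "module.smult (bar_cycles1 G (character_action \<rho>)) = pm_scale"
    by (simp_all add: bar_cycles1_def)
  have coset: "a_r_coset (bar_cycles1 G (character_action \<rho>)) (boundaries \<rho>) x
      = (\<lambda>n. n + x) ` boundaries \<rho>" for x
    by (auto simp: a_r_coset_def r_coset_def ops)
  have add: "set_add (bar_cycles1 G (character_action \<rho>)) = (\<lambda>X Y. \<Union>x\<in>X. \<Union>y\<in>Y. {x + y})"
    by (intro ext) (simp add: set_add_def set_mult_def ops)
  have rc: "A_RCOSETS (bar_cycles1 G (character_action \<rho>)) (boundaries \<rho>)
      = (\<lambda>x. (\<lambda>n. n + x) ` boundaries \<rho>) ` cycles \<rho>"
    using coset by (auto simp: A_RCOSETS_def RCOSETS_def a_r_coset_def c)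
  show ?thesis
    unfolding group_homology1_def quotient_module_def b rc coset add ops
      quotient_space.quotient_def[OF quotient_space_homology[OF assms]]
      quotient_space.coset_def[OF quotient_space_homology[OF assms], abs_def] ..
qed

lemma characteristic_variety_iff:
  "\<rho> \<in> characteristic_variety G \<longleftrightarrow> \<rho> \<in> character_group G \<and> cycles \<rho> \<noteq> boundaries \<rho>"
  using quotient_space.dim_ge_1_iff[OF quotient_space_homology[of \<rho>]]
  by (auto simp: characteristic_variety_def Let_def group_homology1_eq_quotient)

text \<open>The point is that the restriction to \<open>G'\<close> is not zero. A crossed
  homomorphism vanishing on \<open>G'\<close> is \<open>1 - \<rho> g\<close> times a constant, and a
  functional of this form kills every cycle, whereas \<open>\<psi>\<close> was chosen to separate
  \<open>c\<close> from the boundaries.\<close>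

lemma eigenfunction_if_homology:
  assumes \<rho>: "\<rho> \<in> character_group G" and g0: "g0 \<in> carrier G" "\<rho> g0 \<noteq> 1"
    and "cycles \<rho> \<noteq> boundaries \<rho>"
  shows "\<exists>f. eigenfunction \<rho> f"
proof -
  obtain c where c: "c \<in> cycles \<rho>" "c \<notin> boundaries \<rho>"
    using assms boundaries_sub_cycles[OF \<rho>] by blast
  obtain \<psi> where lin: "Vector_Spaces.linear pm_scale (*) \<psi>"
    and \<psi>: "\<And>v. v \<in> boundaries \<rho> \<Longrightarrow> \<psi> v = 0" "\<psi> c = 1"
    using pm.separating_functional[OF subspace_boundaries c(2)] by blast
  interpret \<psi>: Vector_Spaces.linear pm_scale "(*)" \<psi> by (fact lin)
  define \<phi> where "\<phi> g = \<psi> (Poly_Mapping.single g 1)" for g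
  have \<psi>_single: "\<psi> (Poly_Mapping.single g a) = a * \<phi> g" for g a
    using \<psi>.scale[of a "Poly_Mapping.single g 1"] by (simp add: \<phi>_def pm_scale_single)
  \<comment> \<open>The twist belongs to the second argument because \<open>bar_d2\<close> lets
    \<open>h\<close> act on the coefficient; this is the origin of the inverse character in the
    action on \<open>f\<close>.\<close>
  have crossed: "\<phi> (g \<otimes> h) = \<phi> h + \<rho> h * \<phi> g" if "g \<in> carrier G" "h \<in> carrier G" for g h
    using \<psi>(1)[OF boundary_in_boundaries[OF that, of \<rho> 1]]
    by (simp add: boundary_def \<psi>.add \<psi>.diff \<psi>_single algebra_simps)
  have one: "\<phi> \<one> = 0" using crossed[of \<one> \<one>] character_one[OF \<rho>] by simp
  have conj: "\<phi> x = \<rho> g * \<phi> (g \<otimes> x \<otimes> inv g)" if g: "g \<in> carrier G" and x: "x \<in> G'" for g x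
  proof -
    \<comment> \<open>The value at \<open>g \<otimes> x\<close> is expanded in two ways, once with
      \<open>g \<otimes> x \<otimes> inv g\<close> as the first factor.\<close>
    have "\<phi> (g \<otimes> x \<otimes> inv g \<otimes> g) = \<phi> g + \<rho> g * \<phi> (g \<otimes> x \<otimes> inv g)"
      using g x by (intro crossed) auto
    moreover have "g \<otimes> x \<otimes> inv g \<otimes> g = g \<otimes> x"
      using g x by (simp add: m_assoc)
    moreover have "\<phi> (g \<otimes> x) = \<phi> x + \<phi> g"
      using crossed[OF g, of x] x character_derived[OF \<rho> x] by simp
    ultimately show ?thesis by simp
  qed
  define f where "f x = (if x \<in> G' then \<phi> x else 0)" for x
  have "derived_additive f"
    using crossed character_derived[OF \<rho>] subgroup.m_closed[OF derived_subgroup]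
    by (auto simp: derived_additive_def f_def)
  moreover have "\<exists>x. f x \<noteq> 0"
  proof (rule ccontr)
    assume "\<nexists>x. f x \<noteq> 0"
    then have zero: "\<phi> x = 0" if "x \<in> G'" for x using that unfolding f_def by metis
    \<comment> \<open>The two products differ by the left factor \<open>comm g g0\<close>, on which
      \<open>\<phi>\<close> vanishes. Expanding both sides then gives \<open>\<phi> g\<close> in
      terms of \<open>\<phi> g0\<close>, and \<open>\<rho> g0 \<noteq> 1\<close> allows the
      division.\<close>
    have "\<phi> (g \<otimes> g0) = \<phi> (g0 \<otimes> g)" if g: "g \<in> carrier G" for g
      using crossed[of "comm g g0" "g0 \<otimes> g"] comm_swap[OF g g0(1)] zero[OF comm_in_derived[OF g g0(1)]]
        g g0 by simp
    then have "(1 - \<rho> g) * \<phi> g0 = (1 - \<rho> g0) * \<phi> g" if "g \<in> carrier G" for g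
      using that g0 crossed[of g g0] crossed[of g0 g] by (simp add: algebra_simps)
    then have \<phi>: "\<phi> g = (1 - \<rho> g) * (\<phi> g0 / (1 - \<rho> g0))" if "g \<in> carrier G" for g
      using that g0 by (simp add: field_simps)
    have "\<psi> c = (\<Sum>g\<in>Poly_Mapping.keys c. Poly_Mapping.lookup c g * \<phi> g)"
      unfolding \<phi>_def by (rule pm_linear_eq_sum[OF lin])
    also have "\<dots> = (\<Sum>g\<in>Poly_Mapping.keys c.
        (Poly_Mapping.lookup c g - \<rho> g * Poly_Mapping.lookup c g) * (\<phi> g0 / (1 - \<rho> g0)))"
    proof (rule sum.cong)
      fix g assume "g \<in> Poly_Mapping.keys c"
      then have "g \<in> carrier G" using c by (auto simp: cycles_def)
      from \<phi>[OF this] show "Poly_Mapping.lookup c g * \<phi> g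
          = (Poly_Mapping.lookup c g - \<rho> g * Poly_Mapping.lookup c g) * (\<phi> g0 / (1 - \<rho> g0))"
        by (simp only: left_diff_distrib right_diff_distrib mult_1 mult_ac)
    qed simp
    also have "\<dots> = pm_sum (\<lambda>g a. a - \<rho> g * a) c * (\<phi> g0 / (1 - \<rho> g0))"
      by (simp only: pm_sum_def sum_distrib_right)
    also have "\<dots> = 0" using c by (simp add: cycles_def)
    finally show False using \<psi> by simp
  qed
  moreover have "f x = \<rho> g * f (g \<otimes> x \<otimes> inv g)" if "g \<in> carrier G" "x \<in> G'" for g x
    using conj[OF that] derived_conj[OF that] that by (simp add: f_def)
  ultimately show ?thesis unfolding eigenfunction_def by blast
qed

text \<open>An eigenfunction \<open>f\<close> extends, up to a factor, to the crossed homomorphism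
  \<open>g \<mapsto> \<rho> g * f (comm g g0)\<close> on all of \<open>G\<close>.\<close>

lemma homology_if_eigenfunction:
  assumes \<rho>: "\<rho> \<in> character_group G" and g0: "g0 \<in> carrier G" "\<rho> g0 \<noteq> 1"
    and "eigenfunction \<rho> f"
  shows "cycles \<rho> \<noteq> boundaries \<rho>"
proof
  assume eq: "cycles \<rho> = boundaries \<rho>"
  have f: "derived_additive f" and "\<exists>x. f x \<noteq> 0"
    and conj: "\<And>g x. g \<in> carrier G \<Longrightarrow> x \<in> G' \<Longrightarrow> f x = \<rho> g * f (g \<otimes> x \<otimes> inv g)"
    using assms by (auto simp: eigenfunction_def)
  then obtain x where x: "f x \<noteq> 0" "x \<in> G'" using derived_additive_simps(4)[OF f] by metis
  define F where "F g = \<rho> g * f (comm g g0)" for g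
  have crossed: "F (g \<otimes> h) = F h + \<rho> h * F g" if g: "g \<in> carrier G" and h: "h \<in> carrier G" for g h
  proof -
    have "f (comm (g \<otimes> h) g0) = f (g \<otimes> comm h g0 \<otimes> inv g) + f (comm g g0)"
      using g h g0 f
      by (simp add: comm_mult_left derived_additive_simps comm_in_derived derived_conj)
    then show ?thesis
      using conj[OF g comm_in_derived[OF h g0(1)]] character_mult[OF \<rho> g h]
      by (simp add: F_def algebra_simps)
  qed
  \<comment> \<open>\<open>comm x g0\<close> is \<open>x\<close> times a conjugate of
    \<open>inv x\<close>, so on \<open>G'\<close> the function \<open>F\<close> is \<open>f\<close>
    times \<open>1 - 1 / \<rho> g0\<close>. This is the factor that must not vanish.\<close>
  have Fx: "F x \<noteq> 0"
  proof -
    have x': "inv x \<in> G'" using subgroup.m_inv_closed[OF derived_subgroup x(2)] .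
    have "comm x g0 = x \<otimes> (g0 \<otimes> inv x \<otimes> inv g0)"
      using x g0 by (simp add: comm_def m_assoc)
    then have "f (comm x g0) = f x + f (g0 \<otimes> inv x \<otimes> inv g0)"
      using x x' g0 f by (simp add: derived_additive_simps derived_conj)
    moreover have "- f x = \<rho> g0 * f (g0 \<otimes> inv x \<otimes> inv g0)"
      using conj[OF g0(1) x'] f x by (simp add: derived_additive_simps)
    ultimately have "\<rho> g0 * f (comm x g0) = (\<rho> g0 - 1) * f x"
      by (simp add: distrib_left left_diff_distrib flip: \<open>- f x = _\<close>)
    then have "\<rho> g0 * f (comm x g0) \<noteq> 0" using g0 x by simp
    then show ?thesis using character_derived[OF \<rho> x(2)] by (simp add: F_def)
  qed
  define \<psi> where "\<psi> = pm_sum (\<lambda>g a. a * F g)"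
  have \<psi>_add: "\<psi> (u + v) = \<psi> u + \<psi> v" for u v
    unfolding \<psi>_def by (rule pm_sum_add) (simp_all add: algebra_simps)
  have \<psi>_scale: "\<psi> (pm_scale a u) = a * \<psi> u" for a u
    unfolding \<psi>_def by (simp add: pm_sum_scale) (simp add: pm_sum_def sum_distrib_left mult.assoc)
  have \<psi>_single: "\<psi> (Poly_Mapping.single g a) = a * F g" for g a
    unfolding \<psi>_def by (simp add: pm_sum_single)
  have "boundaries \<rho> \<subseteq> {u. \<psi> u = 0}"
  proof (rule boundaries_least)
    show "pm.subspace {u. \<psi> u = 0}"
      by (rule pm.subspaceI) (use \<psi>_single[of \<one> 0] in \<open>auto simp: \<psi>_add \<psi>_scale\<close>)
    fix g h a assume gh: "g \<in> carrier G" "h \<in> carrier G"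
    have "boundary \<rho> (g, h) a = Poly_Mapping.single h a + Poly_Mapping.single (g \<otimes> h) (- a)
        + Poly_Mapping.single g (\<rho> h * a)"
      by (simp add: boundary_def single_uminus)
    then show "boundary \<rho> (g, h) a \<in> {u. \<psi> u = 0}"
      using gh by (simp add: \<psi>_add \<psi>_single crossed algebra_simps)
  qed
  \<comment> \<open>Since \<open>\<rho> x = 1\<close>, the single symbol at \<open>x\<close> is a
    cycle, and \<open>\<psi>\<close> shows that it is not a boundary.\<close>
  moreover have "Poly_Mapping.single x 1 \<in> cycles \<rho>"
    using x character_derived[OF \<rho> x(2)] by (simp add: cycles_def pm_sum_single)
  ultimately have "\<psi> (Poly_Mapping.single x 1) = 0" using eq by blast
  then show False using Fx by (simp add: \<psi>_single)
qed

lemma characteristic_variety_iff_eigenfunction: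
  assumes "\<rho> \<in> character_group G" "g0 \<in> carrier G" "\<rho> g0 \<noteq> 1"
  shows "\<rho> \<in> characteristic_variety G \<longleftrightarrow> (\<exists>f. eigenfunction \<rho> f)"
  using eigenfunction_if_homology[OF assms] homology_if_eigenfunction[OF assms] assms(1)
  by (auto simp: characteristic_variety_iff)

lemma trivial_characters:
  "{\<rho> \<in> character_group G. \<forall>g\<in>carrier G. \<rho> g = 1} \<subseteq> {\<lambda>g. if g \<in> carrier G then 1 else undefined}"
  by (auto simp: character_group_def extensional_def)

text \<open>The eigenfunction criterion is silent on the trivial character, so the two sets may
  differ by that one element.\<close>

lemma finite_characteristic_variety_iff:
  "finite (characteristic_variety G) \<longleftrightarrow> finite {\<rho> \<in> character_group G. \<exists>f. eigenfunction \<rho> f}"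
proof -
  let ?T = "{\<rho> \<in> character_group G. \<forall>g\<in>carrier G. \<rho> g = 1}"
  let ?E = "{\<rho> \<in> character_group G. \<exists>f. eigenfunction \<rho> f}"
  have T: "finite ?T" by (rule finite_subset[OF trivial_characters]) simp
  have "characteristic_variety G \<subseteq> ?E \<union> ?T" "?E \<subseteq> characteristic_variety G \<union> ?T"
    using characteristic_variety_iff_eigenfunction characteristic_variety_iff by blast+
  then show ?thesis using T by (meson finite_Un finite_subset)
qed

end

section \<open>The rational Alexander invariant\<close>

definition tensor_chains :: "('a, 'b) monoid_scheme \<Rightarrow> ('a \<times> rat \<Rightarrow>\<^sub>0 int) set" where
  "tensor_chains A = {c. Poly_Mapping.keys c \<subseteq> carrier A \<times> UNIV}"

lemma rat_scale_simps [simp]: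
  "rat_scale q 0 = 0" "rat_scale q (frag_of (a, r)) = frag_of (a, q * r)"
  "rat_scale q (x + y) = rat_scale q x + rat_scale q y"
  "rat_scale q (x - y) = rat_scale q x - rat_scale q y"
  "rat_scale q (- x) = - rat_scale q x"
  by (simp_all add: rat_scale_def frag_extend_add frag_extend_diff frag_extend_minus)

lemma rat_scale_mult: "rat_scale (q * r) x = rat_scale q (rat_scale r x)"
proof -
  have "Poly_Mapping.keys x \<subseteq> UNIV" by simp
  then show ?thesis
    by (induction x rule: free_Abelian_group_induct) (auto simp: mult.assoc)
qed

lemma rat_scale_one: "rat_scale 1 x = x"
proof -
  have "Poly_Mapping.keys x \<subseteq> UNIV" by simp
  then show ?thesis
    by (induction x rule: free_Abelian_group_induct) auto
qed

lemma tensor_chains_simps [simp]: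
  "0 \<in> tensor_chains A" "frag_of (a, r) \<in> tensor_chains A \<longleftrightarrow> a \<in> carrier A"
  "x \<in> tensor_chains A \<Longrightarrow> y \<in> tensor_chains A \<Longrightarrow> x + y \<in> tensor_chains A"
  "x \<in> tensor_chains A \<Longrightarrow> y \<in> tensor_chains A \<Longrightarrow> x - y \<in> tensor_chains A"
  "x \<in> tensor_chains A \<Longrightarrow> - x \<in> tensor_chains A"
  using keys_add[of x y] keys_diff[of x y] by (auto simp: tensor_chains_def)

lemma tensor_chains_induct [consumes 1, case_names zero diff frag_of]:
  assumes "x \<in> tensor_chains A" "P 0"
    "\<And>x y. x \<in> tensor_chains A \<Longrightarrow> y \<in> tensor_chains A \<Longrightarrow> P x \<Longrightarrow> P y \<Longrightarrow> P (x - y)"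
    "\<And>a r. a \<in> carrier A \<Longrightarrow> P (frag_of (a, r))"
  shows "P x"
proof -
  have "Poly_Mapping.keys x \<subseteq> carrier A \<times> UNIV" using assms(1) by (simp add: tensor_chains_def)
  then show ?thesis
    by (induction x rule: free_Abelian_group_induct) (use assms in \<open>auto simp: tensor_chains_def\<close>)
qed

lemma tensor_chains_scale: "x \<in> tensor_chains A \<Longrightarrow> rat_scale q x \<in> tensor_chains A"
  by (induction rule: tensor_chains_induct) auto

locale mult_closed =
  fixes A :: "('a, 'b) monoid_scheme" (structure)
  assumes mult_closed: "a \<in> carrier A \<Longrightarrow> b \<in> carrier A \<Longrightarrow> a \<otimes> b \<in> carrier A"
begin

text \<open>Membership in the chains is carried through the induction because the group inverse is
  identified with negation only on the carrier.\<close>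

lemma tensor_relations_induct [consumes 1, case_names left right zero uminus add]:
  assumes "x \<in> rat_tensor_relations A"
    and "\<And>a b r. a \<in> carrier A \<Longrightarrow> b \<in> carrier A \<Longrightarrow>
      P (frag_of (a \<otimes> b, r) - frag_of (a, r) - frag_of (b, r))"
    and "\<And>a r s. a \<in> carrier A \<Longrightarrow> P (frag_of (a, r + s) - frag_of (a, r) - frag_of (a, s))"
    and "P 0" "\<And>x. P x \<Longrightarrow> P (- x)" "\<And>x y. P x \<Longrightarrow> P y \<Longrightarrow> P (x + y)"
  shows "x \<in> tensor_chains A \<and> P x"
proof -
  let ?R = "{frag_of (a \<otimes> b, r) - frag_of (a, r) - frag_of (b, r) | a b r.
      a \<in> carrier A \<and> b \<in> carrier A} \<union>
    {frag_of (a, r + s) - frag_of (a, r) - frag_of (a, s) | a r s. a \<in> carrier A}"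
  have R: "y \<in> tensor_chains A \<and> P y" if "y \<in> ?R" for y
    using that assms(2,3) by (auto simp: mult_closed)
  have "x \<in> generate (rat_tensor_gens A) ?R"
    using assms(1) by (simp add: rat_tensor_relations_def)
  then show ?thesis
  proof (induction rule: generate.induct)
    case (inv y)
    have "inv\<^bsub>rat_tensor_gens A\<^esub> y = - y"
      unfolding rat_tensor_gens_def using R[OF inv]
      by (intro inv_free_Abelian_group) (simp add: tensor_chains_def)
    then show ?case using R[OF inv] assms(5) by simp
  qed (use R assms in \<open>auto simp: rat_tensor_gens_def\<close>)
qed

lemma tensor_relations:
  "a \<in> carrier A \<Longrightarrow> b \<in> carrier A \<Longrightarrow>
    frag_of (a \<otimes> b, r) - frag_of (a, r) - frag_of (b, r) \<in> rat_tensor_relations A"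
  "a \<in> carrier A \<Longrightarrow> frag_of (a, r + s) - frag_of (a, r) - frag_of (a, s) \<in> rat_tensor_relations A"
  "0 \<in> rat_tensor_relations A"
  "x \<in> rat_tensor_relations A \<Longrightarrow> y \<in> rat_tensor_relations A \<Longrightarrow> x + y \<in> rat_tensor_relations A"
  "x \<in> rat_tensor_relations A \<Longrightarrow> - x \<in> rat_tensor_relations A"
  "x \<in> rat_tensor_relations A \<Longrightarrow> x \<in> tensor_chains A"
proof -
  let ?R = "{frag_of (a \<otimes> b, r) - frag_of (a, r) - frag_of (b, r) | a b r.
      a \<in> carrier A \<and> b \<in> carrier A} \<union>
    {frag_of (a, r + s) - frag_of (a, r) - frag_of (a, s) | a r s. a \<in> carrier A}"
  interpret F: group "rat_tensor_gens A" by (simp add: rat_tensor_gens_def)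
  have "?R \<subseteq> tensor_chains A"
    using mult_closed by auto
  then have R: "?R \<subseteq> carrier (rat_tensor_gens A)"
    by (simp add: rat_tensor_gens_def free_Abelian_group_def tensor_chains_def)
  interpret N: subgroup "rat_tensor_relations A" "rat_tensor_gens A"
    unfolding rat_tensor_relations_def by (rule F.generate_is_subgroup[OF R])
  show "a \<in> carrier A \<Longrightarrow> b \<in> carrier A \<Longrightarrow>
    frag_of (a \<otimes> b, r) - frag_of (a, r) - frag_of (b, r) \<in> rat_tensor_relations A"
    "a \<in> carrier A \<Longrightarrow> frag_of (a, r + s) - frag_of (a, r) - frag_of (a, s) \<in> rat_tensor_relations A"
    unfolding rat_tensor_relations_def by (rule generate.incl; blast)+
  show "0 \<in> rat_tensor_relations A"
    "x \<in> rat_tensor_relations A \<Longrightarrow> y \<in> rat_tensor_relations A \<Longrightarrow> x + y \<in> rat_tensor_relations A"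
    using N.one_closed N.m_closed by (auto simp: rat_tensor_gens_def)
  show "x \<in> rat_tensor_relations A \<Longrightarrow> x \<in> tensor_chains A"
    using N.subset by (simp add: rat_tensor_gens_def free_Abelian_group_def tensor_chains_def subset_iff)
  then show "x \<in> rat_tensor_relations A \<Longrightarrow> - x \<in> rat_tensor_relations A"
    using N.m_inv_closed[of x] inv_free_Abelian_group[of x "carrier A \<times> UNIV"]
    by (auto simp: rat_tensor_gens_def tensor_chains_def)
qed

sublocale tensor: quotient_space "tensor_chains A" "rat_tensor_relations A" rat_scale
proof
  fix x y :: "'a \<times> rat \<Rightarrow>\<^sub>0 int" and a b :: rat
  show "rat_scale a x \<in> rat_tensor_relations A" if x: "x \<in> rat_tensor_relations A"
  proof -
    have "x \<in> tensor_chains A \<and> rat_scale a x \<in> rat_tensor_relations A"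
      using x
      by (induction rule: tensor_relations_induct) (auto simp: tensor_relations distrib_left)
    then show ?thesis ..
  qed
  show "rat_scale (a + b) x - (rat_scale a x + rat_scale b x) \<in> rat_tensor_relations A"
    if "x \<in> tensor_chains A"
    using that
  proof (induction rule: tensor_chains_induct)
    case (diff x y)
    from tensor_relations(4)[OF diff(3) tensor_relations(5)[OF diff(4)]]
    show ?case by (simp add: algebra_simps)
  next
    case (frag_of c r)
    then show ?case using tensor_relations(2)[of c "a * r" "b * r"]
      by (simp add: distrib_right diff_diff_eq)
  qed (simp add: tensor_relations)
qed (auto simp: tensor_relations tensor_chains_scale rat_scale_mult rat_scale_one)

lemma tensor_rat_eq_quotient: "tensor_rat A = tensor.quotient"
proof -
  have mult: "monoid.mult (rat_tensor_gens A) = (+)"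
    by (intro ext) (simp add: rat_tensor_gens_def)
  have carr: "carrier (rat_tensor_gens A) = tensor_chains A"
    by (simp add: rat_tensor_gens_def free_Abelian_group_def tensor_chains_def)
  have coset: "r_coset (rat_tensor_gens A) (rat_tensor_relations A) = tensor.coset"
    by (intro ext) (auto simp: r_coset_def tensor.coset_def mult)
  have add: "set_mult (rat_tensor_gens A) = (\<lambda>X Y. \<Union>x\<in>X. \<Union>y\<in>Y. {x + y})"
    by (intro ext) (simp add: set_mult_def mult)
  have rc: "RCOSETS (rat_tensor_gens A) (rat_tensor_relations A) = tensor.coset ` tensor_chains A"
    by (auto simp: RCOSETS_def coset carr)
  show ?thesis
    unfolding tensor_rat_def Let_def tensor.quotient_def coset add rc ..
qed

text \<open>A \<open>\<rat>\<close>-spanning set of the tensor product involves finitely many elements of \<open>A\<close>, and additive maps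
  to \<open>\<complex>\<close> extend to the tensor product.\<close>

lemma fin_dim_tensor_imp_finite_detecting_set:
  assumes "vectorspace.fin_dim class_ring (tensor_rat A)"
  shows "\<exists>Y. finite Y \<and> Y \<subseteq> carrier A \<and> (\<forall>f :: 'a \<Rightarrow> complex.
    (\<forall>a\<in>carrier A. \<forall>b\<in>carrier A. f (a \<otimes> b) = f a + f b) \<longrightarrow> (\<forall>y\<in>Y. f y = 0) \<longrightarrow>
    (\<forall>a\<in>carrier A. f a = 0))"
proof -
  obtain F where F: "finite F" "F \<subseteq> tensor_chains A" and gen: "\<And>W. rat_tensor_relations A \<subseteq> W \<Longrightarrow>
    W \<subseteq> tensor_chains A \<Longrightarrow> F \<subseteq> W \<Longrightarrow> \<forall>x\<in>W. \<forall>y\<in>W. x + y \<in> W \<Longrightarrow>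
    \<forall>q. \<forall>x\<in>W. rat_scale q x \<in> W \<Longrightarrow> W = tensor_chains A"
    using assms unfolding tensor_rat_eq_quotient tensor.fin_dim_iff by blast
  define Y where "Y = fst ` (\<Union>c\<in>F. Poly_Mapping.keys c)"
  have "f a = 0" if f: "\<forall>a\<in>carrier A. \<forall>b\<in>carrier A. f (a \<otimes> b) = f a + f b"
    and Y: "\<forall>y\<in>Y. f y = 0" and a: "a \<in> carrier A" for f :: "'a \<Rightarrow> complex" and a
  proof -
    \<comment> \<open>This is the extension of \<open>f\<close> sending the tensor of
      \<open>a\<close> and \<open>r\<close> to \<open>r\<close> times \<open>f a\<close>. Its kernel
      contains the relations and \<open>F\<close>, hence all chains, and \<open>e\<close> at
      \<open>(a, 1)\<close> is \<open>f a\<close>.\<close>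
    define e where "e = pm_sum (\<lambda>(a, r) n. of_int n * of_rat r * f a :: complex)"
    have e_add: "e (x + y) = e x + e y" for x y
      unfolding e_def by (rule pm_sum_add) (auto simp: algebra_simps)
    have e_0: "e 0 = 0" by (simp add: e_def)
    have e_minus: "e (- x) = - e x" for x
      using e_add[of x "- x"] e_0 by (simp add: eq_neg_iff_add_eq_0 add.commute)
    have e_diff: "e (x - y) = e x - e y" for x y
      using e_add[of x "- y"] by (simp add: e_minus)
    have e_frag: "e (frag_of (b, r)) = of_rat r * f b" for b r
      unfolding e_def by (simp add: pm_sum_single)
    have e_scale: "e (rat_scale q x) = of_rat q * e x" if "x \<in> tensor_chains A" for q x
      using that by (induction rule: tensor_chains_induct)
        (auto simp: e_0 e_diff e_frag of_rat_mult algebra_simps)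
    have "{x \<in> tensor_chains A. e x = 0} = tensor_chains A"
    proof (rule gen)
      have "x \<in> tensor_chains A \<and> e x = 0" if "x \<in> rat_tensor_relations A" for x
        using that by (induction rule: tensor_relations_induct)
          (auto simp: e_0 e_diff e_add e_minus e_frag f of_rat_add algebra_simps)
      then show "rat_tensor_relations A \<subseteq> {x \<in> tensor_chains A. e x = 0}" by blast
      have "e x = 0" if "x \<in> F" for x
        unfolding e_def pm_sum_def
        by (rule sum.neutral) (use that Y in \<open>force simp: Y_def\<close>)
      then show "F \<subseteq> {x \<in> tensor_chains A. e x = 0}" using F by blast
    qed (auto simp: e_add e_scale tensor_chains_scale)
    then have "frag_of (a, 1) \<in> {x \<in> tensor_chains A. e x = 0}" using a by simp
    then show ?thesis by (simp add: e_frag)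
  qed
  moreover have "finite Y" using F(1) by (simp add: Y_def)
  moreover have "Y \<subseteq> carrier A"
  proof
    fix y assume "y \<in> Y"
    then obtain c p where "c \<in> F" "p \<in> Poly_Mapping.keys c" "y = fst p" by (auto simp: Y_def)
    moreover have "Poly_Mapping.keys c \<subseteq> carrier A \<times> UNIV"
      using \<open>c \<in> F\<close> F(2) by (auto simp: tensor_chains_def)
    ultimately show "y \<in> carrier A" by auto
  qed
  ultimately show ?thesis by (intro exI[of _ Y] conjI allI impI ballI) simp_all
qed

end

section \<open>Additive functions on the Alexander invariant and their eigencharacters\<close>

context group
begin

definition to_alexander :: "'a \<Rightarrow> 'a set" where
  "to_alexander x = derived G G' #> x"

lemma alexander:
  "carrier (alexander_invariant G) = to_alexander ` G'"
  "x \<in> G' \<Longrightarrow> y \<in> G' \<Longrightarrow> to_alexander x \<otimes>\<^bsub>alexander_invariant G\<^esub> to_alexander y = to_alexander (x \<otimes> y)"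
  "x \<in> G' \<Longrightarrow> y \<in> G' \<Longrightarrow> to_alexander x = to_alexander y \<Longrightarrow> x \<otimes> inv y \<in> derived G G'"
proof -
  interpret H: group "commutator_subgroup G"
    unfolding commutator_subgroup_def by (rule subgroup_imp_group[OF derived_subgroup])
  have K: "carrier (commutator_subgroup (commutator_subgroup G)) = derived G G'"
    using derived_consistent[OF subset_refl derived_subgroup]
    by (simp add: commutator_subgroup_def)
  have carr: "carrier (commutator_subgroup G) = G'" by (simp add: commutator_subgroup_def)
  have coset: "(derived G G') #>\<^bsub>commutator_subgroup G\<^esub> x = to_alexander x" for x
    by (simp add: to_alexander_def r_coset_def commutator_subgroup_def)
  have normal: "derived G G' \<lhd> commutator_subgroup G"
    using derived_subgroup_is_normal[OF derived_subgroup] by (simp add: commutator_subgroup_def)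
  interpret K: normal "derived G G'" "commutator_subgroup G" by (fact normal)
  show "carrier (alexander_invariant G) = to_alexander ` G'"
    unfolding alexander_invariant_def K by (auto simp: FactGroup_def RCOSETS_def coset carr)
  show "to_alexander x \<otimes>\<^bsub>alexander_invariant G\<^esub> to_alexander y = to_alexander (x \<otimes> y)"
    if "x \<in> G'" "y \<in> G'"
    using K.rcos_sum[of x y] that unfolding alexander_invariant_def K
    by (simp add: FactGroup_def coset carr) (simp add: commutator_subgroup_def set_mult_def)
  show "x \<otimes> inv y \<in> derived G G'" if "x \<in> G'" "y \<in> G'" "to_alexander x = to_alexander y"
  proof -
    have "x \<in> to_alexander y"
      using H.rcos_self[of x, OF _ K.subgroup_axioms] that by (simp add: coset carr)
    then obtain k where "k \<in> derived G G'" "x = k \<otimes> y" by (auto simp: to_alexander_def r_coset_def)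
    moreover have "k \<in> carrier G"
      using \<open>k \<in> derived G G'\<close> derived_in_carrier[of G'] derived_in_carrier[of "carrier G"] by blast
    ultimately show ?thesis using that by (simp add: m_assoc)
  qed
qed

lemma mult_closed_alexander: "mult_closed (alexander_invariant G)"
  by unfold_locales
    (auto simp: alexander(1,2) intro!: imageI subgroup.m_closed[OF derived_subgroup])

lemma derived_additive_second_derived:
  fixes f :: "'a \<Rightarrow> 'k::comm_ring_1"
  assumes f: "derived_additive f" and x: "x \<in> derived G G'"
  shows "f x = 0"
proof -
  have "derived G G' \<subseteq> {x \<in> G'. f x = 0}"
    unfolding derived_def[of G G']
  proof (rule generate_subgroup_incl)
    note m = subgroup.m_closed[OF derived_subgroup] subgroup.m_inv_closed[OF derived_subgroup]
    show "derived_set G G' \<subseteq> {x \<in> G'. f x = 0}"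
      using f by (auto simp: m derived_additive_simps)
    show "subgroup {x \<in> G'. f x = 0} G"
      by (rule subgroupI) (use f subgroup.one_closed[OF derived_subgroup] in
          \<open>auto simp: m derived_additive_simps\<close>)
  qed
  then show ?thesis using x by blast
qed

text \<open>An additive function on \<open>G'\<close> kills the second derived subgroup, hence
  descends to the Alexander invariant. Representatives in \<open>G'\<close> of the detecting classes
  therefore detect it.\<close>

lemma fin_dim_imp_finite_detecting_set:
  assumes "vectorspace.fin_dim class_ring (tensor_rat (alexander_invariant G))"
  shows "\<exists>Y. finite Y \<and> (\<forall>f :: 'a \<Rightarrow> complex. derived_additive f \<longrightarrow> (\<forall>y\<in>Y. f y = 0) \<longrightarrow> f = (\<lambda>x. 0))"
proof -
  interpret A: mult_closed "alexander_invariant G" by (rule mult_closed_alexander)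
  let ?A = "alexander_invariant G"
  obtain Z where Z: "finite Z" "Z \<subseteq> to_alexander ` G'" and det: "\<And>f :: 'a set \<Rightarrow> complex.
    (\<forall>a\<in>carrier ?A. \<forall>b\<in>carrier ?A. f (a \<otimes>\<^bsub>?A\<^esub> b) = f a + f b) \<Longrightarrow> (\<forall>z\<in>Z. f z = 0) \<Longrightarrow>
    (\<forall>a\<in>carrier ?A. f a = 0)"
    using A.fin_dim_tensor_imp_finite_detecting_set[OF assms] unfolding alexander(1) by blast
  obtain Y where Y: "Y \<subseteq> G'" "finite Y" "Z = to_alexander ` Y"
    using finite_subset_image[OF Z] by blast
  have "f = (\<lambda>x. 0)" if f: "derived_additive f" and zero: "\<forall>y\<in>Y. f y = 0" for f :: "'a \<Rightarrow> complex"
  proof -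
    define h where "h X = f (SOME x. x \<in> G' \<and> to_alexander x = X)" for X
    have h: "h (to_alexander x) = f x" if x: "x \<in> G'" for x
    proof -
      define y where "y = (SOME y. y \<in> G' \<and> to_alexander y = to_alexander x)"
      have y: "y \<in> G'" "to_alexander y = to_alexander x"
        using someI[of "\<lambda>y. y \<in> G' \<and> to_alexander y = to_alexander x" x] x by (auto simp: y_def)
      have "f (y \<otimes> inv x) = 0"
        using derived_additive_second_derived[OF f alexander(3)[OF y(1) x y(2)]] .
      then show ?thesis
        using f x y subgroup.m_inv_closed[OF derived_subgroup x]
        by (simp add: h_def derived_additive_simps flip: y_def)
    qed
    have "\<forall>a\<in>carrier ?A. h a = 0"
    proof (rule det)
      show "\<forall>a\<in>carrier ?A. \<forall>b\<in>carrier ?A. h (a \<otimes>\<^bsub>?A\<^esub> b) = h a + h b"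
        using f subgroup.m_closed[OF derived_subgroup]
        by (auto simp: alexander h derived_additive_simps)
      show "\<forall>z\<in>Z. h z = 0" using Y zero h by auto
    qed
    then have "f x = 0" if "x \<in> G'" for x using h that by (auto simp: alexander)
    then show ?thesis using derived_additive_simps(4)[OF f] by blast
  qed
  then show ?thesis using Y(2) by blast
qed

text \<open>The argument for eigenvectors: at a \<open>g\<close> where two characters differ, the
  relation at the conjugate of \<open>x\<close> minus \<open>1 / \<sigma> g\<close> times the
  relation at \<open>x\<close> has no \<open>\<sigma>\<close> term left, and its other coefficients
  are multiplied by nonzero numbers where the characters differ at \<open>g\<close>.\<close>

lemma eigenfunctions_independent:
  assumes "finite F" "F \<subseteq> character_group G" "\<And>\<rho>. \<rho> \<in> F \<Longrightarrow> eigenfunction \<rho> (f \<rho>)"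
    "\<And>x. (\<Sum>\<rho>\<in>F. c \<rho> * f \<rho> x) = 0" "\<rho> \<in> F"
  shows "c \<rho> = 0"
  using assms
proof (induction F arbitrary: c \<rho> rule: finite_induct)
  case (insert \<sigma> F)
  have F: "c \<tau> = 0" if \<tau>: "\<tau> \<in> F" for \<tau>
  proof -
    have "\<tau> \<noteq> \<sigma>" using insert \<tau> by blast
    then obtain g where g: "g \<in> carrier G" "\<tau> g \<noteq> \<sigma> g"
      using insert.prems(1) \<tau> extensionalityI[of \<tau> "carrier G" \<sigma>]
      by (auto simp: character_group_def)
    have nz: "\<phi> g \<noteq> 0" if "\<phi> \<in> insert \<sigma> F" for \<phi>
      using insert.prems(1) that g character_nonzero by blast
    have "c \<tau> * (1 / \<tau> g - 1 / \<sigma> g) = 0"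
    proof (rule insert.IH[OF _ _ _ \<tau>])
      fix x
      show "(\<Sum>\<rho>\<in>F. c \<rho> * (1 / \<rho> g - 1 / \<sigma> g) * f \<rho> x) = 0"
      proof (cases "x \<in> G'")
        case True
        have conj: "f \<phi> (g \<otimes> x \<otimes> inv g) = f \<phi> x / \<phi> g" if "\<phi> \<in> insert \<sigma> F" for \<phi>
        proof -
          have "f \<phi> x = \<phi> g * f \<phi> (g \<otimes> x \<otimes> inv g)"
            using insert.prems(2)[OF that] g True unfolding eigenfunction_def by blast
          then show ?thesis using nz[OF that] by simp
        qed
        have "(\<Sum>\<rho>\<in>insert \<sigma> F. c \<rho> * f \<rho> (g \<otimes> x \<otimes> inv g)) = (\<Sum>\<rho>\<in>insert \<sigma> F. c \<rho> * (f \<rho> x / \<rho> g))"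
          by (intro sum.cong) (auto simp: conj)
        then have "(\<Sum>\<rho>\<in>insert \<sigma> F. c \<rho> * (f \<rho> x / \<rho> g)) - (\<Sum>\<rho>\<in>insert \<sigma> F. c \<rho> * f \<rho> x) / \<sigma> g = 0"
          using insert.prems(3)[of "g \<otimes> x \<otimes> inv g"] insert.prems(3)[of x] by simp
        then show ?thesis
          using insert.hyps
          by (simp add: sum_divide_distrib add_divide_distrib algebra_simps flip: sum_subtractf)
      next
        case False
        then have "f \<rho> x = 0" if "\<rho> \<in> F" for \<rho>
          using insert.prems(2)[of \<rho>] that by (auto simp: eigenfunction_def derived_additive_def)
        then show ?thesis by simp
      qed
    qed (use insert.prems in auto)
    then show ?thesis using g nz \<tau> by (auto simp: field_simps)
  qed
  have "eigenfunction \<sigma> (f \<sigma>)" using insert.prems(2) by blast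
  then obtain x where "f \<sigma> x \<noteq> 0" by (auto simp: eigenfunction_def)
  moreover have "c \<sigma> * f \<sigma> x = 0" using insert.prems(3)[of x] F insert.hyps by simp
  ultimately show ?case using F insert.prems(4) by auto
qed simp

text \<open>Evaluation on the finite detecting set is injective on additive functions, so it carries
  the independent eigenfunctions to independent vectors of a finite-dimensional space.\<close>

lemma finite_eigencharacters:
  assumes "vectorspace.fin_dim class_ring (tensor_rat (alexander_invariant G))"
  shows "finite {\<rho> \<in> character_group G. \<exists>f. eigenfunction \<rho> f}"
proof -
  obtain Y where Y: "finite Y" and det: "\<And>f :: 'a \<Rightarrow> complex. derived_additive f \<Longrightarrow> (\<forall>y\<in>Y. f y = 0) \<Longrightarrow>
      f = (\<lambda>x. 0)"
    using fin_dim_imp_finite_detecting_set[OF assms] by blast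
  define E where "E = {\<rho> \<in> character_group G. \<exists>f. eigenfunction \<rho> f}"
  have "\<forall>\<rho>\<in>E. \<exists>f. eigenfunction \<rho> f" by (simp add: E_def)
  then obtain f where f: "\<And>\<rho>. \<rho> \<in> E \<Longrightarrow> eigenfunction \<rho> (f \<rho>)" by metis
  define d where "d \<rho> = (\<Sum>y\<in>Y. Poly_Mapping.single y (f \<rho> y))" for \<rho>
  have d: "Poly_Mapping.lookup (d \<rho>) y = f \<rho> y" if "y \<in> Y" for \<rho> y
    using Y that by (simp add: d_def lookup_sum lookup_single when_def)
  have "\<forall>\<rho>\<in>F. c \<rho> = 0" if F: "finite F" "F \<subseteq> E"
    and rel: "(\<Sum>\<rho>\<in>F. pm_scale (c \<rho>) (d \<rho>)) = 0" for F c
  proof (rule ballI, rule eigenfunctions_independent[where f = f and c = c, OF F(1)])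
    show "F \<subseteq> character_group G" using F by (auto simp: E_def)
    show "eigenfunction \<rho> (f \<rho>)" if "\<rho> \<in> F" for \<rho> using f that F by blast
    have "(\<lambda>x. \<Sum>\<rho>\<in>F. c \<rho> * f \<rho> x) = (\<lambda>x. 0)"
    proof (rule det)
      have "derived_additive (f \<rho>)" if "\<rho> \<in> F" for \<rho>
        using f that F by (auto simp: eigenfunction_def)
      then show "derived_additive (\<lambda>x. \<Sum>\<rho>\<in>F. c \<rho> * f \<rho> x)"
        by (simp add: derived_additive_def distrib_left sum.distrib)
      show "\<forall>y\<in>Y. (\<Sum>\<rho>\<in>F. c \<rho> * f \<rho> y) = 0"
      proof
        fix y assume y: "y \<in> Y"
        show "(\<Sum>\<rho>\<in>F. c \<rho> * f \<rho> y) = 0"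
          using arg_cong[OF rel, of "\<lambda>u. Poly_Mapping.lookup u y"] y
          by (simp add: lookup_sum lookup_pm_scale d)
      qed
    qed
    then show "(\<Sum>\<rho>\<in>F. c \<rho> * f \<rho> x) = 0" for x by meson
  qed assumption
  then have indep: "inj_on d E" "pm.independent (d ` E)"
    by (intro pm.independent_family; blast)+
  define \<delta> where "\<delta> y = Poly_Mapping.single y (1 :: complex)" for y :: 'a
  have "d \<rho> \<in> pm.span (\<delta> ` Y)" for \<rho>
  proof -
    have "d \<rho> = (\<Sum>y\<in>Y. pm_scale (f \<rho> y) (\<delta> y))"
      by (simp add: d_def \<delta>_def pm_scale_single)
    also have "\<dots> \<in> pm.span (\<delta> ` Y)"
      by (intro pm.span_sum pm.span_scale pm.span_base imageI)
    finally show ?thesis .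
  qed
  then have "finite (d ` E)"
    using pm.independent_span_bound[OF _ indep(2), of "\<delta> ` Y"] Y by blast
  then have "finite E" using indep(1) by (rule finite_imageD)
  then show ?thesis by (simp add: E_def)
qed

end

section \<open>The complex Alexander invariant\<close>

lemma pm_subspace_UNIV:
  assumes "pm.subspace W" "\<And>x. Poly_Mapping.single x 1 \<in> W"
  shows "W = UNIV"
proof -
  have "Poly_Mapping.single x a \<in> W" for x a
    using pm.subspace_scale[OF assms(1) assms(2), of a x] by (simp add: pm_scale_single)
  then have "u \<in> W" for u
    by (subst pm_sum_singles[of u]) (intro pm.subspace_sum assms(1))
  then show ?thesis by blast
qed

lemma rational_functional:
  obtains s :: "complex \<Rightarrow> rat" where "\<And>a b. s (a + b) = s a + s b" "s 1 = 1"
proof -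
  interpret Q: vector_space "\<lambda>(q :: rat) (a :: complex). of_rat q * a"
    by unfold_locales (auto simp: algebra_simps of_rat_add of_rat_mult)
  have "Q.subspace {0}" "1 \<notin> {0 :: complex}" by (auto intro: Q.subspaceI)
  from Q.separating_functional[OF this]
  obtain s where lin: "Vector_Spaces.linear (\<lambda>q (a :: complex). of_rat q * a) (*) s" and "s 1 = 1"
    by blast
  interpret s: Vector_Spaces.linear "\<lambda>q (a :: complex). of_rat q * a" "(*)" s by (fact lin)
  show thesis by (rule that[OF s.add \<open>s 1 = 1\<close>])
qed

section \<open>Conjugation on the complexified Alexander invariant\<close>

context group
begin

abbreviation symb :: "'a \<Rightarrow> 'a \<Rightarrow>\<^sub>0 complex" where
  "symb x \<equiv> Poly_Mapping.single x 1"

text \<open>The quotient of the space of complex chains by \<open>derived_relations\<close> is \<open>B(G) \<otimes> \<complex>\<close>; the symbols of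
  elements outside the commutator subgroup are killed as well.\<close>

definition derived_relations :: "('a \<Rightarrow>\<^sub>0 complex) set" where
  "derived_relations = pm.span ({symb (x \<otimes> y) - symb x - symb y | x y. x \<in> G' \<and> y \<in> G'} \<union> {symb z | z. z \<notin> G'})"

definition conj_op :: "'a \<Rightarrow> ('a \<Rightarrow>\<^sub>0 complex) \<Rightarrow> ('a \<Rightarrow>\<^sub>0 complex)" where
  "conj_op g = pm_sum (\<lambda>x a. if x \<in> G' then Poly_Mapping.single (g \<otimes> x \<otimes> inv g) a else 0)"

lemma subspace_derived_relations: "pm.subspace derived_relations"
  by (simp add: derived_relations_def)

lemma derived_relations:
  "x \<in> G' \<Longrightarrow> y \<in> G' \<Longrightarrow> symb (x \<otimes> y) - symb x - symb y \<in> derived_relations"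
  "z \<notin> G' \<Longrightarrow> symb z \<in> derived_relations"
  unfolding derived_relations_def by (rule pm.span_base; blast)+

lemma derived_relations_least:
  assumes "pm.subspace W" "\<And>x y. x \<in> G' \<Longrightarrow> y \<in> G' \<Longrightarrow> symb (x \<otimes> y) - symb x - symb y \<in> W"
    "\<And>z. z \<notin> G' \<Longrightarrow> symb z \<in> W"
  shows "derived_relations \<subseteq> W"
  unfolding derived_relations_def using assms by (intro pm.span_minimal) auto

lemma symb_one: "symb \<one> \<in> derived_relations"
  using pm.subspace_neg[OF subspace_derived_relations derived_relations(1)[of \<one> \<one>]]
    subgroup.one_closed[OF derived_subgroup] by simp

lemma symb_inv:
  assumes "x \<in> G'"
  shows "symb (inv x) + symb x \<in> derived_relations"
proof -
  have "symb (x \<otimes> inv x) - symb x - symb (inv x) \<in> derived_relations"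
    using assms subgroup.m_inv_closed[OF derived_subgroup] by (intro derived_relations) auto
  from pm.subspace_diff[OF subspace_derived_relations symb_one this]
  show ?thesis using assms by (simp add: add.commute)
qed

text \<open>Modulo the relations symbols add up, so conjugation inside \<open>G'\<close> is
  invisible. This is why the conjugation action of \<open>G\<close> on the Alexander invariant
  factors through the abelianization.\<close>

lemma symb_conj_derived:
  assumes c: "c \<in> G'" and x: "x \<in> G'"
  shows "symb (c \<otimes> x \<otimes> inv c) - symb x \<in> derived_relations"
proof -
  note m = subgroup.m_closed[OF derived_subgroup] subgroup.m_inv_closed[OF derived_subgroup]
  have 1: "symb (c \<otimes> x \<otimes> inv c) - symb (c \<otimes> x) - symb (inv c) \<in> derived_relations"
    and 2: "symb (c \<otimes> x) - symb c - symb x \<in> derived_relations"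
    using c x by (auto intro!: derived_relations m)
  have "symb (c \<otimes> x \<otimes> inv c) - symb x
      = (symb (c \<otimes> x \<otimes> inv c) - symb (c \<otimes> x) - symb (inv c)) + (symb (c \<otimes> x) - symb c - symb x)
        + (symb (inv c) + symb c)" by simp
  also have "\<dots> \<in> derived_relations"
    by (intro pm.subspace_add subspace_derived_relations 1 2 symb_inv c)
  finally show ?thesis .
qed

lemma conj_op_symb:
  "conj_op g (symb x) = (if x \<in> G' then symb (g \<otimes> x \<otimes> inv g) else 0)"
  by (simp add: conj_op_def pm_sum_single)

lemma linear_conj_op: "Vector_Spaces.linear pm_scale pm_scale (conj_op g)"
proof -
  have "conj_op g (u + v) = conj_op g u + conj_op g v" for u v
    unfolding conj_op_def by (rule pm_sum_add) (simp_all add: single_add)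
  moreover have "conj_op g (pm_scale c u) = pm_scale c (conj_op g u)" for c u
  proof -
    have "conj_op g (pm_scale c u)
        = pm_sum (\<lambda>x a. pm_scale c (if x \<in> G' then Poly_Mapping.single (g \<otimes> x \<otimes> inv g) a else 0)) u"
      unfolding conj_op_def
      by (subst pm_sum_scale) (simp_all add: pm_sum_def pm_scale_single if_distrib cong: if_cong)
    then show ?thesis by (simp add: conj_op_def pm_sum_def pm.scale_sum_right)
  qed
  ultimately show ?thesis
    by (simp add: Vector_Spaces.linear_iff pm.vector_space_axioms)
qed

lemma conj_op_add: "conj_op g (u + v) = conj_op g u + conj_op g v"
  and conj_op_scale: "conj_op g (pm_scale c u) = pm_scale c (conj_op g u)"
  and conj_op_diff: "conj_op g (u - v) = conj_op g u - conj_op g v"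
  and conj_op_zero: "conj_op g 0 = 0"
proof -
  interpret T: Vector_Spaces.linear pm_scale pm_scale "conj_op g" by (rule linear_conj_op)
  show "conj_op g (u + v) = conj_op g u + conj_op g v"
    "conj_op g (pm_scale c u) = pm_scale c (conj_op g u)"
    "conj_op g (u - v) = conj_op g u - conj_op g v" "conj_op g 0 = 0"
    by (rule T.add T.scale T.diff T.zero)+
qed

lemma conj_op_derived_relations:
  assumes g: "g \<in> carrier G" and "v \<in> derived_relations"
  shows "conj_op g v \<in> derived_relations"
proof -
  have "derived_relations \<subseteq> {v. conj_op g v \<in> derived_relations}"
  proof (rule derived_relations_least)
    show "pm.subspace {v. conj_op g v \<in> derived_relations}"
      using subspace_derived_relations
      by (intro pm.subspaceI)
        (auto simp: conj_op_add conj_op_scale conj_op_zero pm.subspace_add pm.subspace_scale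
          pm.subspace_0)
    fix x y assume xy: "x \<in> G'" "y \<in> G'"
    have "g \<otimes> (x \<otimes> y) \<otimes> inv g = (g \<otimes> x \<otimes> inv g) \<otimes> (g \<otimes> y \<otimes> inv g)"
      using g xy by (simp add: m_assoc cancel_inv)
    then show "symb (x \<otimes> y) - symb x - symb y \<in> {v. conj_op g v \<in> derived_relations}"
      using xy derived_relations(1)[OF derived_conj[OF g xy(1)] derived_conj[OF g xy(2)]]
      by (simp add: conj_op_diff conj_op_symb subgroup.m_closed[OF derived_subgroup])
  qed (simp add: conj_op_symb pm.subspace_0[OF subspace_derived_relations])
  then show ?thesis using assms by blast
qed

lemma conj_op_commute:
  assumes g: "g \<in> carrier G" and h: "h \<in> carrier G"
  shows "conj_op g (conj_op h v) - conj_op h (conj_op g v) \<in> derived_relations"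
proof -
  let ?W = "{v. conj_op g (conj_op h v) - conj_op h (conj_op g v) \<in> derived_relations}"
  have "?W = UNIV"
  proof (rule pm_subspace_UNIV)
    note sub = subspace_derived_relations
    show "pm.subspace ?W"
    proof (rule pm.subspaceI)
      show "0 \<in> ?W" by (simp add: conj_op_zero pm.subspace_0[OF sub])
      show "u + v \<in> ?W" if "u \<in> ?W" "v \<in> ?W" for u v
        using pm.subspace_add[OF sub, of "conj_op g (conj_op h u) - conj_op h (conj_op g u)"
            "conj_op g (conj_op h v) - conj_op h (conj_op g v)"] that
        by (simp add: conj_op_add algebra_simps)
      show "pm_scale c u \<in> ?W" if "u \<in> ?W" for c u
        using pm.subspace_scale[OF sub, of "conj_op g (conj_op h u) - conj_op h (conj_op g u)" c] that
        by (simp add: conj_op_scale pm.scale_right_diff_distrib)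
    qed
    fix x
    show "symb x \<in> ?W"
    proof (cases "x \<in> G'")
      case True
      \<comment> \<open>\<open>y\<close> is the conjugate of \<open>x\<close> by
        \<open>h \<otimes> g\<close>; conjugating it further by \<open>comm g h\<close>, which lies
        in \<open>G'\<close>, gives the conjugate by \<open>g \<otimes> h\<close>.\<close>
      define y where "y = h \<otimes> (g \<otimes> x \<otimes> inv g) \<otimes> inv h"
      have y: "y \<in> G'" unfolding y_def using True g h by (simp add: derived_conj)
      have "g \<otimes> (h \<otimes> x \<otimes> inv h) \<otimes> inv g = comm g h \<otimes> y \<otimes> inv (comm g h)"
        using True g h by (simp add: y_def comm_def m_assoc cancel_inv inv_mult_group)
      then show ?thesis
        using True symb_conj_derived[OF comm_in_derived[OF g h] y]
        by (simp add: conj_op_symb derived_conj g h y_def)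
    next
      case False
      then show ?thesis by (simp add: conj_op_symb conj_op_zero pm.subspace_0[OF sub])
    qed
  qed
  then show ?thesis by blast
qed

text \<open>\<open>g \<mapsto> comm g k\<close> is a crossed homomorphism, so its values stay in the
  normal subgroup \<open>D\<close> once they do so on generators.\<close>

lemma comm_generate_in:
  assumes D: "subgroup D G" and conj: "\<And>g x. g \<in> carrier G \<Longrightarrow> x \<in> D \<Longrightarrow> g \<otimes> x \<otimes> inv g \<in> D"
    and S: "S \<subseteq> carrier G" and k: "k \<in> carrier G" and "\<And>s. s \<in> S \<Longrightarrow> comm s k \<in> D"
    and g: "g \<in> generate G S"
  shows "comm g k \<in> D"
  using g
proof (induction rule: generate.induct)
  case one
  then show ?case using k subgroup.one_closed[OF D] by (simp add: comm_def)
next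
  case (incl s)
  then show ?case by fact
next
  case (inv s)
  have s: "s \<in> carrier G" using inv S by blast
  have "inv s \<otimes> inv (comm s k) \<otimes> inv (inv s) \<in> D"
    using assms inv s by (intro conj subgroup.m_inv_closed[OF D]) auto
  moreover have "inv s \<otimes> inv (comm s k) \<otimes> inv (inv s) = comm (inv s) k"
    using s k by (simp add: comm_def m_assoc inv_mult_group cancel_inv)
  ultimately show ?case by simp
next
  case (eng g h)
  then have "g \<in> carrier G" "h \<in> carrier G" using generate_in_carrier[OF S] by blast+
  then show ?case
    using eng k conj subgroup.m_closed[OF D] by (simp add: comm_mult_left)
qed

text \<open>\<open>comm_generate_in\<close> passes from generators to the group in the first
  argument only. It is applied twice, with inversion of the commutator exchanging the arguments in
  between.\<close>

lemma derived_normally_generated: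
  assumes D: "subgroup D G" and S: "S \<subseteq> carrier G" "generate G S = carrier G"
    and conj: "\<And>s x. s \<in> S \<union> m_inv G ` S \<Longrightarrow> x \<in> D \<Longrightarrow> s \<otimes> x \<otimes> inv s \<in> D"
    and comm: "\<And>s t. s \<in> S \<Longrightarrow> t \<in> S \<Longrightarrow> comm s t \<in> D"
  shows "G' \<subseteq> D"
proof (rule derived_least[OF D])
  have conj': "g \<otimes> x \<otimes> inv g \<in> D" if "g \<in> carrier G" "x \<in> D" for g x
    using that(1)[folded S(2)] that(2)
  proof (induction arbitrary: x rule: generate.induct)
    case (eng g h)
    then have "g \<in> carrier G" "h \<in> carrier G" using generate_in_carrier[OF S(1)] by blast+
    moreover have "x \<in> carrier G" using eng subgroup.mem_carrier[OF D] by blast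
    ultimately show ?case
      using eng.IH(1)[OF eng.IH(2)[OF eng.prems]] by (simp add: m_assoc inv_mult_group)
  qed (use conj S(1) subgroup.mem_carrier[OF D] in auto)
  fix g h assume gh: "g \<in> carrier G" "h \<in> carrier G"
  have "comm h s \<in> D" if "s \<in> S" for s
    by (rule comm_generate_in[OF D conj' S(1)]) (use gh comm that S in auto)
  then have "inv (comm h s) \<in> D" if "s \<in> S" for s
    using that by (intro subgroup.m_inv_closed[OF D])
  moreover have "inv (comm h s) = comm s h" if "s \<in> S" for s
    using gh S(1) that by (auto simp: comm_def m_assoc inv_mult_group subset_iff)
  ultimately have "comm s h \<in> D" if "s \<in> S" for s using that by metis
  then show "comm g h \<in> D"
    using gh S by (auto intro: comm_generate_in[OF D conj' S(1) gh(2)])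
qed

text \<open>For the generation axiom, the elements of \<open>G'\<close> whose symbol lies in
  \<open>W\<close> form a subgroup, to which \<open>derived_normally_generated\<close> applies. The
  inverses of the generators are among the operators because normal generation conjugates by
  both.\<close>

lemma commuting_operators_conj:
  assumes S: "finite S" "S \<subseteq> carrier G" "generate G S = carrier G"
  shows "commuting_operators pm_scale conj_op (S \<union> m_inv G ` S)
    ((\<lambda>(s, t). symb (comm s t)) ` (S \<times> S)) derived_relations"
proof (intro commuting_operators.intro commuting_operators_axioms.intro pm.vector_space_axioms)
  have I: "s \<in> carrier G" if "s \<in> S \<union> m_inv G ` S" for s using that S by auto
  show "conj_op i v \<in> derived_relations" if "i \<in> S \<union> m_inv G ` S" "v \<in> derived_relations" for i v
    using that I conj_op_derived_relations by blast
  show "conj_op i (conj_op j v) - conj_op j (conj_op i v) \<in> derived_relations"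
    if "i \<in> S \<union> m_inv G ` S" "j \<in> S \<union> m_inv G ` S" for i j v
    using that I conj_op_commute by blast
  fix W assume W: "pm.subspace W" "(\<lambda>(s, t). symb (comm s t)) ` (S \<times> S) \<subseteq> W" "derived_relations \<subseteq> W"
    and T: "\<And>i v. i \<in> S \<union> m_inv G ` S \<Longrightarrow> v \<in> W \<Longrightarrow> conj_op i v \<in> W"
  define D where "D = {x \<in> G'. symb x \<in> W}"
  note m = subgroup.m_closed[OF derived_subgroup] subgroup.m_inv_closed[OF derived_subgroup]
  have D: "subgroup D G"
  proof (rule subgroupI)
    show "D \<subseteq> carrier G" by (auto simp: D_def)
    have "\<one> \<in> D" using symb_one W(3) subgroup.one_closed[OF derived_subgroup] by (auto simp: D_def)
    then show "D \<noteq> {}" by blast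
    show "inv x \<in> D" if x: "x \<in> D" for x
    proof -
      have "(symb (inv x) + symb x) - symb x \<in> W"
        using x W(3) symb_inv by (intro pm.subspace_diff[OF W(1)]) (auto simp: D_def)
      then show ?thesis using x by (simp add: D_def m)
    qed
    show "x \<otimes> y \<in> D" if x: "x \<in> D" and y: "y \<in> D" for x y
    proof -
      have "(symb (x \<otimes> y) - symb x - symb y) + (symb x + symb y) \<in> W"
        using x y W(3) derived_relations(1)
        by (intro pm.subspace_add[OF W(1)]) (auto simp: D_def)
      then show ?thesis using x y by (simp add: D_def m)
    qed
  qed
  have "G' \<subseteq> D"
  proof (rule derived_normally_generated[OF D S(2,3)])
    show "s \<otimes> x \<otimes> inv s \<in> D" if "s \<in> S \<union> m_inv G ` S" "x \<in> D" for s x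
      using T[OF that(1), of "symb x"] that I[OF that(1)]
      by (simp add: D_def conj_op_symb derived_conj)
    show "comm s t \<in> D" if st: "s \<in> S" "t \<in> S" for s t
    proof -
      have "(\<lambda>(s, t). symb (comm s t)) (s, t) \<in> W" using W(2) st by blast
      moreover have "s \<in> carrier G" "t \<in> carrier G" using st S(2) by blast+
      ultimately show ?thesis by (simp add: D_def comm_in_derived)
    qed
  qed
  show "W = UNIV"
  proof (rule pm_subspace_UNIV[OF W(1)])
    show "symb x \<in> W" for x
      using \<open>G' \<subseteq> D\<close> W(3) derived_relations(2) by (cases "x \<in> G'") (auto simp: D_def)
  qed
qed (use S in \<open>auto simp: linear_conj_op subspace_derived_relations\<close>)

text \<open>The eigenvector property passes from generators and inverses to products. The
  eigenvalues are read off at \<open>x0\<close>, where \<open>f\<close> is nonzero, and are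
  therefore multiplicative.\<close>

lemma eigencharacter_exists:
  assumes S: "S \<subseteq> carrier G" "generate G S = carrier G"
    and f: "derived_additive f" "f x0 \<noteq> 0"
    and eig: "\<And>i. i \<in> S \<union> m_inv G ` S \<Longrightarrow> \<exists>b. \<forall>x\<in>G'. f (i \<otimes> x \<otimes> inv i) = b * f x"
  shows "\<exists>\<rho>\<in>character_group G. eigenfunction \<rho> f"
proof -
  have x0: "x0 \<in> G'" using f by (auto simp: derived_additive_def)
  have ex: "\<exists>b. \<forall>x\<in>G'. f (g \<otimes> x \<otimes> inv g) = b * f x" if "g \<in> carrier G" for g
    using that[folded S(2)]
  proof (induction rule: generate.induct)
    case one
    then show ?case by (intro exI[of _ 1]) simp
  next
    case (eng g h)
    then obtain b c where b: "\<forall>x\<in>G'. f (g \<otimes> x \<otimes> inv g) = b * f x"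
      and c: "\<forall>x\<in>G'. f (h \<otimes> x \<otimes> inv h) = c * f x" by blast
    have gh: "g \<in> carrier G" "h \<in> carrier G" using eng generate_in_carrier[OF S(1)] by blast+
    have "f (g \<otimes> h \<otimes> x \<otimes> inv (g \<otimes> h)) = b * c * f x" if "x \<in> G'" for x
    proof -
      have "g \<otimes> h \<otimes> x \<otimes> inv (g \<otimes> h) = g \<otimes> (h \<otimes> x \<otimes> inv h) \<otimes> inv g"
        using gh that by (simp add: m_assoc inv_mult_group)
      then show ?thesis using b c that derived_conj[OF gh(2) that] by simp
    qed
    then show ?case by blast
  qed (use eig in auto)
  then obtain b where b: "\<And>g x. g \<in> carrier G \<Longrightarrow> x \<in> G' \<Longrightarrow> f (g \<otimes> x \<otimes> inv g) = b g * f x"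
    by metis
  have b_mult: "b (g \<otimes> h) = b g * b h" if gh: "g \<in> carrier G" "h \<in> carrier G" for g h
  proof -
    have "g \<otimes> h \<otimes> x0 \<otimes> inv (g \<otimes> h) = g \<otimes> (h \<otimes> x0 \<otimes> inv h) \<otimes> inv g"
      using gh x0 by (simp add: m_assoc inv_mult_group)
    then have "f (g \<otimes> h \<otimes> x0 \<otimes> inv (g \<otimes> h)) = b g * (b h * f x0)"
      by (simp only: b[OF gh(1) derived_conj[OF gh(2) x0]] b[OF gh(2) x0])
    then have "b (g \<otimes> h) * f x0 = b g * (b h * f x0)"
      by (simp only: b[OF m_closed[OF gh] x0])
    then show ?thesis using f(2) by auto
  qed
  have "b \<one> = 1" using b[of \<one> x0] x0 f by simp
  then have b_nz: "b g \<noteq> 0" if "g \<in> carrier G" for g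
    using b_mult[of g "inv g"] that by auto
  \<comment> \<open>The inverse is due to \<open>eigenfunction\<close>, which puts
    \<open>\<rho> g\<close> on the side of the conjugated argument.\<close>
  define \<rho> where "\<rho> = restrict (\<lambda>g. inverse (b g)) (carrier G)"
  have "a \<in> Units class_ring" if "a \<noteq> 0" for a :: complex
    using that by (auto simp: Units_def intro!: exI[of _ "inverse a"])
  then have "\<rho> \<in> character_group G"
    using b_mult b_nz by (auto simp: character_group_def hom_def units_of_def \<rho>_def)
  moreover have "eigenfunction \<rho> f"
    using f b b_nz by (auto simp: eigenfunction_def \<rho>_def)
  ultimately show ?thesis by blast
qed

text \<open>Infinite codimension would give one operator \<open>conj_op i\<close> infinitely many
  eigenvalues. Each is \<open>inverse (\<rho> i)\<close> for some eigencharacter, so finitely many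
  characters cannot account for them.\<close>

lemma finite_codim_derived_relations:
  assumes S: "finite S" "S \<subseteq> carrier G" "generate G S = carrier G"
    and fin: "finite {\<rho> \<in> character_group G. \<exists>f. eigenfunction \<rho> f}"
  shows "\<exists>Y. finite Y \<and> pm.span (Y \<union> derived_relations) = UNIV"
proof (rule ccontr)
  define E where "E = {\<rho> \<in> character_group G. \<exists>f. eigenfunction \<rho> f}"
  interpret commuting_operators pm_scale conj_op "S \<union> m_inv G ` S"
    "(\<lambda>(s, t). symb (comm s t)) ` (S \<times> S)" derived_relations
    by (rule commuting_operators_conj[OF S])
  assume "\<not> ?thesis"
  then obtain i where i: "i \<in> S \<union> m_inv G ` S" and
    "infinite {a. \<exists>\<phi>. Vector_Spaces.linear pm_scale (*) \<phi> \<and> (\<forall>v\<in>derived_relations. \<phi> v = 0) \<and>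
    (\<exists>v. \<phi> v \<noteq> 0) \<and> (\<forall>j\<in>S \<union> m_inv G ` S. \<exists>b. \<forall>v. \<phi> (conj_op j v) = b * \<phi> v) \<and>
    (\<forall>v. \<phi> (conj_op i v) = a * \<phi> v)}" (is "infinite ?A")
    using infinitely_many_eigenvalues by blast
  moreover have "?A \<subseteq> (\<lambda>\<rho>. inverse (\<rho> i)) ` E"
  proof
    fix a assume "a \<in> ?A"
    then obtain \<phi> where lin: "Vector_Spaces.linear pm_scale (*) \<phi>"
      and zero: "\<forall>v\<in>derived_relations. \<phi> v = 0" and nz: "\<exists>v. \<phi> v \<noteq> 0"
      and eig: "\<forall>j\<in>S \<union> m_inv G ` S. \<exists>b. \<forall>v. \<phi> (conj_op j v) = b * \<phi> v"
      and a: "\<forall>v. \<phi> (conj_op i v) = a * \<phi> v" by blast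
    interpret \<phi>: Vector_Spaces.linear pm_scale "(*)" \<phi> by (fact lin)
    define f where "f x = \<phi> (symb x)" for x
    have f_add: "f (x \<otimes> y) = f x + f y" if "x \<in> G'" "y \<in> G'" for x y
      using zero derived_relations(1)[OF that] unfolding f_def
      by (metis \<phi>.diff diff_diff_eq eq_iff_diff_eq_0)
    have "f z = 0" if "z \<notin> G'" for z
      using zero derived_relations(2)[OF that] unfolding f_def by blast
    with f_add have f: "derived_additive f" by (simp add: derived_additive_def)
    obtain x where x: "f x \<noteq> 0"
      using nz pm_linear_eq_sum[OF lin] by (metis (no_types, lifting) f_def mult_zero_right sum.neutral)
    have f_conj: "f (j \<otimes> x \<otimes> inv j) = \<phi> (conj_op j (symb x))" if "x \<in> G'" for j x
      using that by (simp add: f_def conj_op_symb)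
    have "\<exists>b. \<forall>x\<in>G'. f (j \<otimes> x \<otimes> inv j) = b * f x" if "j \<in> S \<union> m_inv G ` S" for j
      using eig that f_conj unfolding f_def by metis
    then obtain \<rho> where \<rho>: "\<rho> \<in> character_group G" "eigenfunction \<rho> f"
      using eigencharacter_exists[OF S(2,3) f x] by blast
    have iG: "i \<in> carrier G" using i S by auto
    have "x \<in> G'" using x f by (auto simp: derived_additive_def)
    then have "f x = \<rho> i * (a * f x)"
      using \<rho>(2) iG a f_conj[of x i] unfolding eigenfunction_def f_def by metis
    then have "a = inverse (\<rho> i)"
      using x by (simp add: inverse_unique)
    then show "a \<in> (\<lambda>\<rho>. inverse (\<rho> i)) ` E" using \<rho> by (auto simp: E_def)
  qed
  moreover have "finite ((\<lambda>\<rho>. inverse (\<rho> i)) ` E)" using fin by (simp add: E_def)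
  ultimately show False using finite_subset by blast
qed

text \<open>A \<open>\<rat>\<close>-linear retraction \<open>s\<close> of \<open>\<complex>\<close> onto \<open>\<rat>\<close> turns a relation between symbols with complex
  coefficients into one with rational coefficients. The induced map \<open>\<Phi>\<close> on chains is additive only
  modulo the relations of the tensor product.\<close>

lemma fin_dim_if_finite_codim:
  assumes Y: "finite Y" "pm.span (Y \<union> derived_relations) = UNIV"
  shows "vectorspace.fin_dim class_ring (tensor_rat (alexander_invariant G))"
proof -
  let ?A = "alexander_invariant G"
  let ?N = "rat_tensor_relations ?A"
  interpret A: mult_closed ?A by (rule mult_closed_alexander)
  obtain s :: "complex \<Rightarrow> rat" where s_add: "\<And>a b. s (a + b) = s a + s b" and s_one: "s 1 = 1"
    using rational_functional by blast
  have s_zero: "s 0 = 0" using s_add[of 0 0] by simp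
  define e where "e x q = frag_of (to_alexander x, q)" for x and q :: rat
  have A: "to_alexander x \<in> carrier ?A" if "x \<in> G'" for x
    using that by (simp add: alexander(1))
  have e_mult: "e (x \<otimes> y) q - e x q - e y q \<in> ?N" if "x \<in> G'" "y \<in> G'" for x y q
    using A.tensor_relations(1)[OF A[OF that(1)] A[OF that(2)], of q] that by (simp add: e_def alexander(2))
  have e_plus: "e x (q + r) - e x q - e x r \<in> ?N" if "x \<in> G'" for x q r
    using A.tensor_relations(2)[OF A[OF that]] by (simp add: e_def)
  have e_zero: "e x 0 \<in> ?N" if "x \<in> G'" for x
    using A.tensor.N_minus[OF e_plus[OF that, of 0 0]] by simp
  \<comment> \<open>The coefficient 0 must give exactly 0 for sums over keys to be independent of
    the index set, whereas \<open>e x 0\<close> is only a relation.\<close>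
  define h where "h x a = (if x \<in> G' \<and> a \<noteq> 0 then e x (s a) else 0)" for x a
  have h_zero: "h x 0 = 0" for x by (simp add: h_def)
  have h_e: "h x a - e x (s a) \<in> ?N" if "x \<in> G'" for x a
    using e_zero[OF that] A.tensor.N_zero A.tensor.N_minus that by (auto simp: h_def s_zero)
  have h_add: "h x (a + b) - (h x a + h x b) \<in> ?N" for x a b
  proof (cases "x \<in> G'")
    case True
    have "h x (a + b) - (h x a + h x b) = ((h x (a + b) - e x (s (a + b)))
        + (e x (s a + s b) - e x (s a) - e x (s b))) - ((h x a - e x (s a)) + (h x b - e x (s b)))"
      by (simp add: s_add)
    also have "\<dots> \<in> ?N"
      by (intro A.tensor.N_diff A.tensor.N_add h_e[OF True] e_plus[OF True])
    finally show ?thesis .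
  qed (simp add: h_def A.tensor.N_zero)
  have N_sum: "(\<Sum>x\<in>K. u x) \<in> ?N" if "\<And>x. x \<in> K \<Longrightarrow> u x \<in> ?N" for K and u :: "'a \<Rightarrow> _"
    using that by (induction K rule: infinite_finite_induct) (auto simp: A.tensor.N_zero A.tensor.N_add)
  define \<Phi> where "\<Phi> = pm_sum h"
  have \<Phi>_add: "\<Phi> (u + v) - (\<Phi> u + \<Phi> v) \<in> ?N" for u v
  proof -
    let ?K = "Poly_Mapping.keys u \<union> Poly_Mapping.keys v"
    have "\<Phi> (u + v) - (\<Phi> u + \<Phi> v) = (\<Sum>x\<in>?K. h x (Poly_Mapping.lookup u x + Poly_Mapping.lookup v x)
        - (h x (Poly_Mapping.lookup u x) + h x (Poly_Mapping.lookup v x)))"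
      using keys_add[of u v]
      by (simp add: \<Phi>_def pm_sum_superset[of ?K] h_zero lookup_add sum.distrib sum_subtractf)
    also have "\<dots> \<in> ?N" by (intro N_sum h_add)
    finally show ?thesis .
  qed
  have \<Phi>_single: "\<Phi> (Poly_Mapping.single x a) = h x a" for x a
    by (simp add: \<Phi>_def pm_sum_single h_zero)
  \<comment> \<open>The keys of \<open>Y\<close> in \<open>G'\<close> are finitely many; their
    tensors with 1 will span over the rationals.\<close>
  define K where "K = G' \<inter> (\<Union>y\<in>Y. Poly_Mapping.keys y)"
  have "W = tensor_chains ?A" if W: "?N \<subseteq> W" "W \<subseteq> tensor_chains ?A" "(\<lambda>x. e x 1) ` K \<subseteq> W"
    and W_add: "\<forall>x\<in>W. \<forall>y\<in>W. x + y \<in> W" and W_scale: "\<forall>q. \<forall>x\<in>W. rat_scale q x \<in> W" for W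
  proof -
    have W_zero: "0 \<in> W" using W(1) A.tensor.N_zero by blast
    have W_minus: "- x \<in> W" if x: "x \<in> W" for x
    proof -
      have "rat_scale (- 1) x \<in> W" using x W_scale by blast
      moreover have "- x - rat_scale (- 1) x \<in> ?N"
      proof -
        have x': "x \<in> tensor_chains ?A" using x W(2) by blast
        have "rat_scale 0 x - (rat_scale 0 x + rat_scale 0 x) \<in> ?N"
          using A.tensor.sc_plus[OF x', of 0 0] by simp
        moreover have "rat_scale 0 x - (x + rat_scale (- 1) x) \<in> ?N"
          using A.tensor.sc_plus[OF x', of 1 "- 1"] by (simp add: rat_scale_one)
        ultimately have "(rat_scale 0 x - (x + rat_scale (- 1) x))
            + (rat_scale 0 x - (rat_scale 0 x + rat_scale 0 x)) \<in> ?N"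
          by (intro A.tensor.N_add)
        then show ?thesis by (simp add: algebra_simps)
      qed
      ultimately have "(- x - rat_scale (- 1) x) + rat_scale (- 1) x \<in> W"
        using W(1) W_add by blast
      then show ?thesis by simp
    qed
    have W_cong: "u \<in> W" if "u - v \<in> ?N" "v \<in> W" for u v
    proof -
      have "(u - v) + v \<in> W" using that W(1) W_add by blast
      then show ?thesis by simp
    qed
    have W_sum: "(\<Sum>x\<in>L. u x) \<in> W" if "\<And>x. x \<in> L \<Longrightarrow> u x \<in> W" for L and u :: "'a \<Rightarrow> _"
      using that by (induction L rule: infinite_finite_induct) (auto simp: W_zero W_add)
    have \<Phi>_add_W: "\<Phi> (u + v) \<in> W" if "\<Phi> u \<in> W" "\<Phi> v \<in> W" for u v
      using W_cong[OF \<Phi>_add] that W_add by blast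
    \<comment> \<open>\<open>W\<close> is closed only under rational scalars. Quantifying over all
      complex \<open>c\<close> makes \<open>W'\<close> a complex subspace.\<close>
    define W' where "W' = {v. \<forall>c. \<Phi> (pm_scale c v) \<in> W}"
    have sub: "pm.subspace W'"
    proof (rule pm.subspaceI)
      show "0 \<in> W'" by (simp add: W'_def \<Phi>_def W_zero)
      show "u + v \<in> W'" if "u \<in> W'" "v \<in> W'" for u v
        using that \<Phi>_add_W by (simp add: W'_def pm.scale_right_distrib)
      show "pm_scale c u \<in> W'" if "u \<in> W'" for c u
        using that by (simp add: W'_def)
    qed
    have "Y \<subseteq> W'"
    proof
      fix y assume y: "y \<in> Y"
      have "h x a \<in> W" if "x \<in> Poly_Mapping.keys y" for x a
      proof (cases "x \<in> G' \<and> a \<noteq> 0")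
        case True
        then have "e x 1 \<in> W" using W(3) y that by (auto simp: K_def)
        then have "rat_scale (s a) (e x 1) \<in> W" using W_scale by blast
        then show ?thesis using True by (simp add: h_def e_def)
      next
        case False
        then have "h x a = 0" by (auto simp: h_def)
        then show ?thesis by (simp add: W_zero)
      qed
      then have "\<Phi> (pm_scale c y) \<in> W" for c
        unfolding \<Phi>_def by (simp add: pm_sum_scale h_zero) (auto simp: pm_sum_def intro!: W_sum)
      then show "y \<in> W'" by (simp add: W'_def)
    qed
    moreover have "derived_relations \<subseteq> W'"
    proof (rule derived_relations_least[OF sub])
      fix x y assume xy: "x \<in> G'" "y \<in> G'"
      have "\<Phi> (pm_scale c (symb (x \<otimes> y) - symb x - symb y)) \<in> W" for c
      proof -
        have xy': "x \<otimes> y \<in> G'" using xy by (rule subgroup.m_closed[OF derived_subgroup])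
        have eq: "pm_scale c (symb (x \<otimes> y) - symb x - symb y)
            = Poly_Mapping.single (x \<otimes> y) c + (Poly_Mapping.single x (- c) + Poly_Mapping.single y (- c))"
          by (simp add: pm.scale_right_diff_distrib pm_scale_single single_uminus)
        \<comment> \<open>Taking the sign out of the tensor uses the relation for
          \<open>s c + - s c\<close> and the fact that \<open>e z 0\<close> is a relation.\<close>
        have neg: "h z (- c) + e z (s c) \<in> ?N" if "z \<in> G'" for z
        proof -
          have s: "s (- c) = - s c" using s_add[of c "- c"] s_zero by simp
          have "h z (- c) + e z (s c) = ((h z (- c) - e z (s (- c))) + e z 0)
              - (e z (s c + - s c) - e z (s c) - e z (- s c))"
            by (simp add: s)
          also have "\<dots> \<in> ?N"
            by (intro A.tensor.N_diff A.tensor.N_add h_e e_zero e_plus that)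
          finally show ?thesis .
        qed
        define P where "P = \<Phi> (Poly_Mapping.single x (- c) + Poly_Mapping.single y (- c))"
        have P: "P - (h x (- c) + h y (- c)) \<in> ?N"
          unfolding P_def using \<Phi>_add[of "Poly_Mapping.single x (- c)" "Poly_Mapping.single y (- c)"]
          by (simp add: \<Phi>_single)
        have "\<Phi> (pm_scale c (symb (x \<otimes> y) - symb x - symb y)) - (h (x \<otimes> y) c + P) \<in> ?N"
          unfolding eq P_def
          using \<Phi>_add[of "Poly_Mapping.single (x \<otimes> y) c"
              "Poly_Mapping.single x (- c) + Poly_Mapping.single y (- c)"]
          by (simp add: \<Phi>_single)
        moreover have "h (x \<otimes> y) c + P = (h (x \<otimes> y) c - e (x \<otimes> y) (s c))
            + (P - (h x (- c) + h y (- c))) + (h x (- c) + e x (s c)) + (h y (- c) + e y (s c))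
            + (e (x \<otimes> y) (s c) - e x (s c) - e y (s c))" by simp
        moreover have "\<dots> \<in> ?N"
          by (intro A.tensor.N_add h_e xy' P neg xy e_mult)
        ultimately show ?thesis using W_cong W(1) by (metis subsetD)
      qed
      then show "symb (x \<otimes> y) - symb x - symb y \<in> W'" by (simp add: W'_def)
    next
      fix z assume "z \<notin> G'"
      then show "symb z \<in> W'" by (simp add: W'_def pm_scale_single \<Phi>_single h_def W_zero)
    qed
    ultimately have "pm.span (Y \<union> derived_relations) \<subseteq> W'"
      using sub by (intro pm.span_minimal) auto
    then have W': "W' = UNIV" using Y by auto
    have e1: "e x 1 \<in> W" if "x \<in> G'" for x
    proof -
      have "symb x \<in> W'" using W' by simp
      then have "\<Phi> (pm_scale 1 (symb x)) \<in> W" unfolding W'_def by blast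
      then show ?thesis using that by (simp add: \<Phi>_single h_def s_one)
    qed
    have "z \<in> W" if "z \<in> tensor_chains ?A" for z
      using that
    proof (induction rule: tensor_chains_induct)
      case (diff x y)
      then show ?case using W_add W_minus by (metis diff_conv_add_uminus)
    next
      case (frag_of a r)
      then obtain x where "x \<in> G'" "a = to_alexander x" by (auto simp: alexander(1))
      moreover have "rat_scale r (e x 1) \<in> W" using W_scale e1 \<open>x \<in> G'\<close> by blast
      ultimately show ?case by (simp add: e_def)
    qed (rule W_zero)
    then show ?thesis using W(2) by blast
  qed
  moreover have "finite ((\<lambda>x. e x 1) ` K)" using Y(1) by (simp add: K_def)
  moreover have "(\<lambda>x. e x 1) ` K \<subseteq> tensor_chains ?A"
    using A by (auto simp: K_def e_def)
  ultimately show ?thesis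
    unfolding A.tensor_rat_eq_quotient A.tensor.fin_dim_iff
    by (intro exI[of _ "(\<lambda>x. e x 1) ` K"]) simp
qed

end

theorem proposition1p4:
  fixes G :: "('a, 'b) monoid_scheme"
  assumes "finitely_generated_group G"
  shows "vectorspace.fin_dim class_ring (tensor_rat (alexander_invariant G))
         \<longleftrightarrow> finite (characteristic_variety G)"
proof -
  interpret group G using assms by (simp add: finitely_generated_group_def)
  obtain S where S: "finite S" "S \<subseteq> carrier G" "generate G S = carrier G"
    using assms by (auto simp: finitely_generated_group_def)
  show ?thesis
    unfolding finite_characteristic_variety_iff
    using finite_eigencharacters finite_codim_derived_relations[OF S] fin_dim_if_finite_codim by blast
qed

end
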